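(* The following hold, where $o(1)$ denotes a quantity tending to $0$ as $m\to\infty$ (with $k$ fixed), and the upper bounds in (2) and (3) hold for every positive integer $m$. \begin{enumerate} \item $\rho(C_4,m)=(1+o(1))\dfrac{m^2}{4}$. \item $(1+o(1))\left(\dfrac{m}{6}\right)^{3}\le \rho(C_6,m)\le 3\left(\dfrac{m}{6}\right)^{3}$. \item For every even integer $k=2l\ge 8$, $$(1+o(1))\left(\frac{m}{k}\right)^{k/2}\le \rho(C_k,m)\le \left(\frac{m}{2l}\right)^{l}\left(1+\frac{1}{l-1}\right)^{l-1}\le e\left(\frac{m}{k}\right)^{k/2}.$$ \end{enumerate}
   Context: Graphs are finite, simple and undirected. $C_k$ denotes the cycle on $k$ vertices. For graphs $G$ and $H$, $c(G,H)$ is the number of induced copies of $H$ in $G$, i.e. the number of subsets $S\subseteq V(G)$ such that the induced subgraph $G[S]$ is isomorphic to $H$. For a positive integer $m$, $\rho(H,m)=\max\{c(G,H) : G \text{ a graph with } |E(G)|=m\}$ (the number of vertices of $G$ is not restricted). Here $e$ is the base of the natural logarithm. *)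

theory Defs
  imports Complex_Main
begin

text \<open>Pairs of a vertex set and a set of unordered edges; the type alone imposes no condition,
  see \<open>simple_graph\<close> below.\<close>

type_synonym 'a graph = "'a set \<times> 'a set set"

abbreviation verts :: "'a graph \<Rightarrow> 'a set" where
  "verts G \<equiv> fst G"

abbreviation edges :: "'a graph \<Rightarrow> 'a set set" where
  "edges G \<equiv> snd G"

definition simple_graph :: "'a graph \<Rightarrow> bool" where
  "simple_graph G \<longleftrightarrow> finite (verts G) \<and> (\<forall>e\<in>edges G. e \<subseteq> verts G \<and> card e = 2)"

definition induced_subgraph :: "'a graph \<Rightarrow> 'a set \<Rightarrow> 'a graph" where
  "induced_subgraph G S = (S, {e \<in> edges G. e \<subseteq> S})"

definition graph_iso :: "'a graph \<Rightarrow> 'b graph \<Rightarrow> bool" where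
  "graph_iso G H \<longleftrightarrow>
     (\<exists>f. bij_betw f (verts G) (verts H) \<and>
          (\<forall>u\<in>verts G. \<forall>v\<in>verts G. {u, v} \<in> edges G \<longleftrightarrow> {f u, f v} \<in> edges H))"

definition induced_count :: "'a graph \<Rightarrow> 'b graph \<Rightarrow> nat" where
  "induced_count G H = card {S. S \<subseteq> verts G \<and> graph_iso (induced_subgraph G S) H}"

text \<open>This is the cycle only for \<open>k \<ge> 3\<close>; for \<open>k = 1\<close> the only \<open>edge\<close> is the singleton \<open>{0}\<close>,
  and for \<open>k = 2\<close> the result is a single edge.\<close>

definition cycle_graph :: "nat \<Rightarrow> nat graph" where
  "cycle_graph k = ({..<k}, {{i, Suc i mod k} | i. i < k})"

text \<open>Every finite graph is isomorphic to one with vertices in \<^typ>\<open>nat\<close>, so ranging over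
  these loses nothing. If \<open>H\<close> has no isolated vertices (as for cycles), a copy of \<open>H\<close> lies within
  the at most \<open>2 * m\<close> non-isolated vertices of \<open>G\<close>, so the set below is finite and \<^const>\<open>Max\<close>
  is a genuine maximum; otherwise it may be unbounded and \<open>rho H m\<close> is then meaningless.\<close>

definition rho :: "'b graph \<Rightarrow> nat \<Rightarrow> nat" where
  "rho H m = Max {induced_count G H | G :: nat graph. simple_graph G \<and> card (edges G) = m}"

end

theory Submission
  imports Defs
begin

text \<open>
  Fix a random induced cycle of length \<open>2 * l\<close> and reveal it through the \<open>l\<close> arcs of a perfect matching,
  in cyclic order. Since the cycle is induced, an arc that continues the revealed path is attached to
  the path only at its last vertex (and the last arc also at the first vertex). Concavity of the
  logarithm bounds the number of rooted oriented cycles by \<open>(2 * m) ^ l\<close> times the product of the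
  probabilities \<open>p i\<close> that the first arc of a second, independent random cycle could be used in step \<open>i\<close>.

  Averaging over the \<open>2 * l\<close> rotations of the first cycle, an arc and its reverse together can be used
  for at most \<open>l\<close> starting points when \<open>l \<ge> 4\<close>, so the \<open>p i\<close> add up to at most \<open>1 / 4\<close>.
  For \<open>l = 3\<close> this fails: an edge joined to two opposite vertices of a 6-cycle is usable too often.
  But if many edges of one 6-cycle are of this kind with respect to another, then
  few edges of the latter are of this kind with respect to the former; this gives
  \<open>3 * p 1 + 4 * p 2 \<le> 1\<close>, which suffices.

  The lower bounds come from complete bipartite graphs and from even cycles in which every second
  vertex is replaced by many copies.
\<close>

text \<open>The weights of the arcs make the method work. In each step the next arc is drawn from
  the possible ones with probability proportional to the law of the first arc of a random cycle. By
  rotation every arc of a random cycle has this law, so an arc costs at most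
  \<open>ln (2 * m)\<close> on average. The normalizing factor of step \<open>i\<close> averages to
  an event about two independent cycles, which may be rotated, reflected and, for
  \<open>l = 3\<close>, exchanged.

  The constants follow from the inequality between arithmetic and geometric means. If the
  \<open>p i\<close> add up to at most 1/4, their product is at most
  \<open>(1 / (4 * (l - 1))) ^ (l - 1)\<close>; dividing by the \<open>4 * l\<close> maps per copy
  gives (3). For \<open>l = 3\<close>, \<open>p 1 * p 2 <= 1 / 48\<close> gives
  \<open>8 * m ^ 3 / (48 * 12) = 3 * (m / 6) ^ 3\<close>. The limit 1/4 would give the factor 9/4
  instead of 3, but an edge joined to two opposite vertices of a 6-cycle has four usable starting
  points, where only three are allowed.\<close>

section \<open>Induced cycles as periodic maps\<close>

text \<open>Cycles are indexed periodically by the integers, so that rotations and reflections become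
  translations and sign changes of the index.\<close>

definition cycle_maps :: "'a graph \<Rightarrow> nat \<Rightarrow> (int \<Rightarrow> 'a) set" where
  "cycle_maps G k = {w. range w \<subseteq> verts G \<and> (\<forall>i j. w i = w j \<longleftrightarrow> int k dvd i - j) \<and>
     (\<forall>i j. {w i, w j} \<in> edges G \<longleftrightarrow> int k dvd i - j - 1 \<or> int k dvd i - j + 1)}"

lemma cycle_maps_eq_iff: "w \<in> cycle_maps G k \<Longrightarrow> w i = w j \<longleftrightarrow> int k dvd i - j"
  by (simp add: cycle_maps_def)

lemma cycle_maps_edge_iff:
  "w \<in> cycle_maps G k \<Longrightarrow> {w i, w j} \<in> edges G \<longleftrightarrow> int k dvd i - j - 1 \<or> int k dvd i - j + 1"
  by (simp add: cycle_maps_def)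

lemma cycle_maps_shift:
  assumes "w \<in> cycle_maps G k"
  shows "(\<lambda>i. w (s + i)) \<in> cycle_maps G k"
  using assms by (auto simp: cycle_maps_def)

lemma cycle_maps_reflect:
  assumes "w \<in> cycle_maps G k"
  shows "(\<lambda>i. w (s - i)) \<in> cycle_maps G k"
proof -
  have 1: "int k dvd s - i - (s - j) \<longleftrightarrow> int k dvd i - j" for i j
    using dvd_minus_iff[of "int k" "i - j"] by simp
  have 2: "int k dvd s - i - (s - j) - 1 \<longleftrightarrow> int k dvd i - j + 1" for i j
    using dvd_minus_iff[of "int k" "i - j + 1"] by (simp add: algebra_simps)
  have 3: "int k dvd s - i - (s - j) + 1 \<longleftrightarrow> int k dvd i - j - 1" for i j
    using dvd_minus_iff[of "int k" "i - j - 1"] by (simp add: algebra_simps)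
  from assms show ?thesis
    unfolding cycle_maps_def mem_Collect_eq by (auto simp only: 1 2 3)
qed

lemma sum_cycle_maps_shift:
  "(\<Sum>w\<in>cycle_maps G k. \<phi> (\<lambda>i. w (s + i))) = (\<Sum>w\<in>cycle_maps G k. \<phi> w)"
  by (rule sum.reindex_bij_witness[of _ "\<lambda>w i. w (i - s)" "\<lambda>w i. w (s + i)"])
    (auto simp: cycle_maps_shift intro: cycle_maps_shift[of _ G k "- s", simplified])

lemma sum_cycle_maps_reflect:
  "(\<Sum>w\<in>cycle_maps G k. \<phi> (\<lambda>i. w (s - i))) = (\<Sum>w\<in>cycle_maps G k. \<phi> w)"
  by (rule sum.reindex_bij_witness[of _ "\<lambda>w i. w (s - i)" "\<lambda>w i. w (s - i)"])
    (simp_all add: cycle_maps_reflect)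

lemma cycle_maps_eqI:
  assumes w: "w \<in> cycle_maps G k" and w': "w' \<in> cycle_maps G k" and k: "k > 0"
    and eq: "\<And>i. 0 \<le> i \<Longrightarrow> i < int k \<Longrightarrow> w i = w' i"
  shows "w = w'"
proof
  fix i
  have "w i = w (i mod int k)" "w' i = w' (i mod int k)"
    by (simp_all only: cycle_maps_eq_iff[OF w] cycle_maps_eq_iff[OF w'] dvd_minus_mod)
  with eq k show "w i = w' i" by simp
qed

lemma finite_cycle_maps:
  assumes "finite (verts G)" "k > 0"
  shows "finite (cycle_maps G k)"
proof (rule finite_imageD)
  let ?F = "\<lambda>w. map (\<lambda>i. w (int i)) [0..<k]"
  show "inj_on ?F (cycle_maps G k)"
  proof (rule inj_onI)
    fix w w' assume *: "w \<in> cycle_maps G k" "w' \<in> cycle_maps G k" "?F w = ?F w'"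
    show "w = w'"
    proof (rule cycle_maps_eqI[OF *(1,2) assms(2)])
      fix i :: int assume "0 \<le> i" "i < int k"
      then have "nat i \<in> set [0..<k]" by (simp add: nat_less_iff)
      with *(3) have "w (int (nat i)) = w' (int (nat i))" by (meson map_eq_conv)
      with \<open>0 \<le> i\<close> show "w i = w' i" by simp
    qed
  qed
  have "?F ` cycle_maps G k \<subseteq> {xs. set xs \<subseteq> verts G \<and> length xs = k}"
    by (auto simp: cycle_maps_def image_subset_iff)
  then show "finite (?F ` cycle_maps G k)"
    by (rule finite_subset) (rule finite_lists_length_eq[OF assms(1)])
qed

section \<open>Parametrizations of the induced copies of a cycle\<close>

lemma cycle_graph_doubleton:
  assumes "a < k" "b < k"
  shows "{a, b} \<in> edges (cycle_graph k) \<longleftrightarrow> a = Suc b mod k \<or> b = Suc a mod k"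
  using assms by (auto simp: cycle_graph_def doubleton_eq_iff)

lemma cycle_graph_edge_iff:
  assumes "k > 0"
  shows "{nat (i mod int k), nat (j mod int k)} \<in> edges (cycle_graph k) \<longleftrightarrow>
    int k dvd i - j - 1 \<or> int k dvd i - j + 1"
proof -
  have red: "nat (a mod int k) = Suc (nat (b mod int k)) mod k \<longleftrightarrow> int k dvd a - b - 1" for a b
  proof -
    have "nat (a mod int k) = Suc (nat (b mod int k)) mod k \<longleftrightarrow>
        int (nat (a mod int k)) = int (Suc (nat (b mod int k)) mod k)"
      by linarith
    also have "\<dots> \<longleftrightarrow> a mod int k = (1 + b mod int k) mod int k"
      using assms by (simp add: zmod_int)
    also have "\<dots> \<longleftrightarrow> a mod int k = (1 + b) mod int k" by (simp add: mod_simps)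
    also have "\<dots> \<longleftrightarrow> int k dvd a - b - 1" by (simp add: mod_eq_dvd_iff algebra_simps)
    finally show ?thesis .
  qed
  have "{nat (i mod int k), nat (j mod int k)} \<in> edges (cycle_graph k) \<longleftrightarrow>
      nat (i mod int k) = Suc (nat (j mod int k)) mod k \<or> nat (j mod int k) = Suc (nat (i mod int k)) mod k"
    using assms by (intro cycle_graph_doubleton) (simp_all add: nat_less_iff)
  also have "\<dots> \<longleftrightarrow> int k dvd i - j - 1 \<or> int k dvd j - i - 1" by (simp only: red)
  also have "int k dvd j - i - 1 \<longleftrightarrow> int k dvd i - j + 1"
    using dvd_minus_iff[of "int k" "i - j + 1"] by (simp add: algebra_simps)
  finally show ?thesis .
qed

lemma induced_cycle_imp_cycle_map:
  assumes "S \<subseteq> verts G" "graph_iso (induced_subgraph G S) (cycle_graph k)" "k > 0"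
  shows "\<exists>w\<in>cycle_maps G k. range w = S"
proof -
  from assms(2) obtain f where f: "bij_betw f S {..<k}"
    and e: "\<And>u v. u \<in> S \<Longrightarrow> v \<in> S \<Longrightarrow> {u, v} \<in> edges G \<longleftrightarrow> {f u, f v} \<in> edges (cycle_graph k)"
    unfolding graph_iso_def induced_subgraph_def by (auto simp: cycle_graph_def)
  define h where "h = the_inv_into S f"
  have h: "bij_betw h {..<k} S" unfolding h_def by (rule bij_betw_the_inv_into[OF f])
  have fh: "f (h a) = a" if "a < k" for a
    unfolding h_def using f that by (simp add: f_the_inv_into_f_bij_betw)
  define w where "w = (\<lambda>i. h (nat (i mod int k)))"
  have lt: "nat (i mod int k) < k" for i using assms(3) by (simp add: nat_less_iff)
  have wS: "w i \<in> S" for i using bij_betwE[OF h] lt by (auto simp: w_def)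
  have fw: "f (w i) = nat (i mod int k)" for i by (simp add: w_def fh lt)
  have "range w = S"
  proof
    show "S \<subseteq> range w"
    proof
      fix x assume "x \<in> S"
      then obtain a where a: "a < k" "x = h a" using h by (auto simp: bij_betw_def)
      then have "x = w (int a)" by (simp add: w_def)
      then show "x \<in> range w" by simp
    qed
  qed (use wS in auto)
  moreover have "w i = w j \<longleftrightarrow> int k dvd i - j" for i j
  proof -
    have "w i = w j \<longleftrightarrow> f (w i) = f (w j)"
      using f wS by (auto simp: bij_betw_def inj_on_def)
    also have "\<dots> \<longleftrightarrow> i mod int k = j mod int k"
      using assms(3) by (simp add: fw nat_eq_iff)
    finally show ?thesis by (simp add: mod_eq_dvd_iff)
  qed
  moreover have "{w i, w j} \<in> edges G \<longleftrightarrow> int k dvd i - j - 1 \<or> int k dvd i - j + 1" for i j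
    using e[OF wS wS] cycle_graph_edge_iff[OF assms(3)] by (simp only: fw)
  ultimately show ?thesis
    using assms(1) unfolding cycle_maps_def by (intro bexI[of _ w]) auto
qed

text \<open>The cyclic order of a copy can be read from any of its \<open>k\<close> vertices in two directions.\<close>

lemma induced_count_le_cycle_maps:
  assumes fin: "finite (verts G)" and k: "k \<ge> 3"
  shows "2 * k * induced_count G (cycle_graph k) \<le> card (cycle_maps G k)"
proof -
  let ?W = "cycle_maps G k"
  let ?\<S> = "{S. S \<subseteq> verts G \<and> graph_iso (induced_subgraph G S) (cycle_graph k)}"
  have finW: "finite ?W" using finite_cycle_maps[OF fin] k by simp
  have fins: "finite ?\<S>" using fin by simp
  have fibre: "2 * k \<le> card {w \<in> ?W. range w = S}" if S: "S \<in> ?\<S>" for S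
  proof -
    obtain w where w: "w \<in> ?W" "range w = S"
      using induced_cycle_imp_cycle_map[of S G k] S k by auto
    \<comment> \<open>\<open>F\<close> runs through the reparametrizations of \<open>w\<close> by
      starting point \<open>s\<close> and direction \<open>b\<close>. With equal starts, opposite
      directions agree at index 1 only if \<open>k\<close> divides 2, which \<open>k >= 3\<close>
      excludes.\<close>
    define F where "F = (\<lambda>(s, b) i. w (if b then s + i else s - i))"
    have "inj_on F ({0..<int k} \<times> UNIV)"
    proof (rule inj_onI, clarify)
      fix s b s' b' assume s: "s \<in> {0..<int k}" "s' \<in> {0..<int k}" and "F (s, b) = F (s', b')"
      then have *: "int k dvd (if b then s + i else s - i) - (if b' then s' + i else s' - i)" for i
        using cycle_maps_eq_iff[OF w(1)] unfolding F_def by (simp add: fun_eq_iff)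
      from *[of 0] have "int k dvd s - s'" by (simp split: if_splits)
      then have "s mod int k = s' mod int k" by (simp add: mod_eq_dvd_iff)
      with s have "s = s'" by simp
      moreover have "b = b'"
      proof (rule ccontr)
        assume "b \<noteq> b'"
        with *[of 1] \<open>s = s'\<close> have "int k dvd 2" by (auto split: if_splits)
        then show False using k zdvd_imp_le[of "int k" 2] by simp
      qed
      ultimately show "s = s' \<and> b = b'" by simp
    qed
    then have "card (F ` ({0..<int k} \<times> (UNIV::bool set))) = 2 * k"
      by (simp add: card_image card_cartesian_product)
    moreover have sub: "F ` ({0..<int k} \<times> UNIV) \<subseteq> {w \<in> ?W. range w = S}"
    proof clarify
      fix s :: int and b
      have "w i \<in> range (\<lambda>i. w (s + i))" "w i \<in> range (\<lambda>i. w (s - i))" for i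
        by (rule range_eqI[of _ _ "i - s"], simp) (rule range_eqI[of _ _ "s - i"], simp)
      then have "range (\<lambda>i. w (s + i)) = range w" "range (\<lambda>i. w (s - i)) = range w"
        by auto
      then show "F (s, b) \<in> ?W \<and> range (F (s, b)) = S"
        using w cycle_maps_shift[OF w(1), of s] cycle_maps_reflect[OF w(1), of s]
        unfolding F_def by (cases b) (simp_all only: prod.case if_True if_False simp_thms)
    qed
    moreover have "card (F ` ({0..<int k} \<times> UNIV)) \<le> card {w \<in> ?W. range w = S}"
      by (rule card_mono[OF _ sub]) (use finW in simp)
    ultimately show ?thesis by simp
  qed
  have "2 * k * card ?\<S> = (\<Sum>S\<in>?\<S>. 2 * k)" by simp
  also have "\<dots> \<le> (\<Sum>S\<in>?\<S>. card {w \<in> ?W. range w = S})"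
    by (rule sum_mono) (rule fibre)
  also have "\<dots> = card (\<Union>S\<in>?\<S>. {w \<in> ?W. range w = S})"
    by (rule card_UN_disjoint[symmetric]) (use fins finW in auto)
  also have "\<dots> \<le> card ?W" by (rule card_mono[OF finW]) auto
  finally show ?thesis unfolding induced_count_def .
qed

section \<open>Counting cycles arc by arc\<close>

text \<open>Jensen's inequality for the logarithm, from the tangent \<open>ln x <= x - 1\<close>
  after scaling by the mean \<open>A\<close>.\<close>

lemma sum_ln_le_card_mult_ln_mean:
  fixes f :: "'a \<Rightarrow> real"
  assumes fin: "finite X" and ne: "X \<noteq> {}" and pos: "\<And>x. x \<in> X \<Longrightarrow> f x > 0"
  shows "(\<Sum>x\<in>X. ln (f x)) \<le> real (card X) * ln ((\<Sum>x\<in>X. f x) / real (card X))"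
proof -
  define A where "A = (\<Sum>x\<in>X. f x) / real (card X)"
  have c: "real (card X) > 0" using fin ne by (simp add: card_gt_0_iff)
  have A: "A > 0" unfolding A_def using c by (intro divide_pos_pos sum_pos fin ne pos) auto
  have "(\<Sum>x\<in>X. ln (f x) - ln A) \<le> (\<Sum>x\<in>X. f x / A - 1)"
  proof (rule sum_mono)
    fix x assume "x \<in> X"
    then have "f x / A > 0" using pos A by simp
    from ln_le_minus_one[OF this] show "ln (f x) - ln A \<le> f x / A - 1"
      using pos[OF \<open>x \<in> X\<close>] A by (simp add: ln_div)
  qed
  also have "\<dots> = (\<Sum>x\<in>X. f x) / A - real (card X)"
    by (simp add: sum_subtractf sum_divide_distrib)
  also have "\<dots> = 0" using A c unfolding A_def by (simp add: field_simps)
  finally show ?thesis by (simp add: sum_subtractf A_def)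
qed

text \<open>Draw each entry from the set \<open>N p\<close> allowed after the prefix
  \<open>p\<close>, with probability proportional to \<nu>. The summand is the probability of
  drawing \<open>u\<close>, and different sequences are disjoint events. The induction splits off
  the last entry because \<open>N\<close> looks at the entries before it.\<close>

lemma chain_weight_sum_le_one:
  fixes \<nu> :: "'b \<Rightarrow> real" and N :: "'b list \<Rightarrow> 'b set"
  assumes \<nu>: "\<And>a. \<nu> a \<ge> 0" and N: "\<And>p. finite (N p)"
    and "finite X" and "\<And>u. u \<in> X \<Longrightarrow> length u = n"
    and "\<And>u i. u \<in> X \<Longrightarrow> i < n \<Longrightarrow> u ! i \<in> N (take i u)"
  shows "(\<Sum>u\<in>X. \<Prod>i<n. \<nu> (u ! i) / sum \<nu> (N (take i u))) \<le> 1"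
  using assms(3-)
proof (induction n arbitrary: X)
  case 0
  then have "X \<subseteq> {[]}" by auto
  then have "card X \<le> 1" using card_mono[of "{[]}" X] by simp
  then show ?case by simp
next
  case (Suc n)
  let ?Q = "\<lambda>u. \<Prod>i<n. \<nu> (u ! i) / sum \<nu> (N (take i u))"
  have step: "(\<Sum>u | u \<in> X \<and> butlast u = p. \<nu> (last u) / sum \<nu> (N p)) \<le> 1" for p
  proof -
    let ?Y = "{u \<in> X. butlast u = p}"
    have ne: "u \<noteq> []" if "u \<in> X" for u using Suc.prems(2)[OF that] by auto
    have inj: "inj_on last ?Y"
    proof (rule inj_onI)
      fix u v assume *: "u \<in> ?Y" "v \<in> ?Y" "last u = last v"
      with ne[of u] ne[of v] show "u = v"
        by (metis (mono_tags, lifting) append_butlast_last_id mem_Collect_eq)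
    qed
    have "last u \<in> N p" if "u \<in> ?Y" for u
    proof -
      have l: "length u = Suc n" "u \<in> X" using that Suc.prems(2) by auto
      then have "take n u = p" "last u = u ! n"
        using that by (auto simp: butlast_conv_take last_conv_nth ne)
      with Suc.prems(3)[OF l(2), of n] show ?thesis by simp
    qed
    then have sub: "last ` ?Y \<subseteq> N p" by blast
    have "(\<Sum>u\<in>?Y. \<nu> (last u)) = sum \<nu> (last ` ?Y)" by (simp add: sum.reindex[OF inj])
    also have "\<dots> \<le> sum \<nu> (N p)" by (rule sum_mono2[OF N sub]) (rule \<nu>)
    finally have "(\<Sum>u\<in>?Y. \<nu> (last u)) \<le> sum \<nu> (N p)" .
    moreover have "sum \<nu> (N p) \<ge> 0" by (simp add: \<nu> sum_nonneg)
    \<comment> \<open>If \<nu> has mass 0 on \<open>N p\<close>, the quotients are 0 by the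
      convention on division.\<close>
    ultimately show ?thesis
      by (cases "sum \<nu> (N p) = 0") (simp_all add: sum_divide_distrib[symmetric])
  qed
  have Q: "(\<Prod>i<Suc n. \<nu> (u ! i) / sum \<nu> (N (take i u))) =
      ?Q (butlast u) * (\<nu> (last u) / sum \<nu> (N (butlast u)))" if "u \<in> X" for u
  proof -
    have l: "length u = Suc n" using that Suc.prems(2) by auto
    then have "take n u = butlast u" "last u = u ! n"
      by (simp add: butlast_conv_take) (metis l last_conv_nth length_0_conv nat.distinct(1) diff_Suc_1)
    moreover have "butlast u ! i = u ! i" "take i (butlast u) = take i u" if "i < n" for i
      using l that by (simp_all add: nth_butlast take_butlast)
    ultimately show ?thesis by simp
  qed
  have "(\<Sum>u\<in>X. \<Prod>i<Suc n. \<nu> (u ! i) / sum \<nu> (N (take i u))) =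
      (\<Sum>u\<in>X. ?Q (butlast u) * (\<nu> (last u) / sum \<nu> (N (butlast u))))"
    by (rule sum.cong) (simp_all only: Q)
  also have "\<dots> = (\<Sum>p\<in>butlast ` X. \<Sum>u | u \<in> X \<and> butlast u = p.
      ?Q (butlast u) * (\<nu> (last u) / sum \<nu> (N (butlast u))))"
    using Suc.prems(1) by (intro sum.group[symmetric]) auto
  also have "\<dots> = (\<Sum>p\<in>butlast ` X. ?Q p *
      (\<Sum>u | u \<in> X \<and> butlast u = p. \<nu> (last u) / sum \<nu> (N p)))"
    by (simp add: sum_distrib_left)
  also have "\<dots> \<le> (\<Sum>p\<in>butlast ` X. ?Q p * 1)"
    by (intro sum_mono mult_left_mono step prod_nonneg) (simp add: \<nu> sum_nonneg)
  also have "\<dots> \<le> 1"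
  proof -
    have "(\<Sum>p\<in>butlast ` X. ?Q p) \<le> 1"
    proof (rule Suc.IH)
      fix p i assume "p \<in> butlast ` X"
      then obtain u where u: "u \<in> X" "p = butlast u" by auto
      then have l: "length u = Suc n" using Suc.prems(2) by auto
      show "length p = n" using u l by simp
      show "p ! i \<in> N (take i p)" if "i < n"
        using Suc.prems(3)[OF u(1), of i] that u(2) l by (simp add: nth_butlast take_butlast)
    qed (use Suc.prems(1) in simp)
    then show ?thesis by simp
  qed
  finally show ?case .
qed

section \<open>Arcs and the arc-by-arc bound\<close>

lemma finite_arcs:
  assumes "simple_graph G"
  shows "finite {(x, y). {x, y} \<in> edges G}"
proof (rule finite_subset)
  show "{(x, y). {x, y} \<in> edges G} \<subseteq> verts G \<times> verts G"
    using assms by (auto simp: simple_graph_def)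
qed (use assms in \<open>simp add: simple_graph_def\<close>)

lemma finite_edges:
  assumes "simple_graph G"
  shows "finite (edges G)"
  by (rule finite_subset[of _ "Pow (verts G)"]) (use assms in \<open>auto simp: simple_graph_def\<close>)

lemma card_arcs_le:
  assumes "simple_graph G"
  shows "card {(x, y). {x, y} \<in> edges G} \<le> 2 * card (edges G)"
proof -
  have "card {(x, y). {x, y} = e} \<le> 2" if "e \<in> edges G" for e
  proof -
    from that assms obtain a b where "e = {a, b}" by (auto simp: simple_graph_def card_2_iff)
    then have "{(x, y). {x, y} = e} \<subseteq> {(a, b), (b, a)}" by (auto simp: doubleton_eq_iff)
    from card_mono[OF _ this] show ?thesis by (simp add: card_insert_if split: if_splits)
  qed
  then have "(\<Sum>e\<in>edges G. card {(x, y). {x, y} = e}) \<le> (\<Sum>e\<in>edges G. 2)" by (rule sum_mono)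
  moreover have "{(x, y). {x, y} \<in> edges G} = (\<Union>e\<in>edges G. {(x, y). {x, y} = e})" by auto
  ultimately show ?thesis
    using card_UN_le[OF finite_edges[OF assms], of "\<lambda>e. {(x, y). {x, y} = e}"] by simp
qed

text \<open>The arcs that can follow the path \<open>v 0, \<dots>, v (2 * i - 1)\<close> in an induced cycle of length
  \<open>2 * l\<close>; for \<open>i = l - 1\<close> the arc must also close up the cycle at \<open>v 0\<close>.\<close>

definition extending_arcs :: "'a graph \<Rightarrow> nat \<Rightarrow> nat \<Rightarrow> (nat \<Rightarrow> 'a) \<Rightarrow> ('a \<times> 'a) set" where
  "extending_arcs G l i v = {(x, y). {x, y} \<in> edges G \<and>
     (i > 0 \<longrightarrow> {x, v (2 * i - 1)} \<in> edges G \<and> (\<forall>j<2 * i - 1. {x, v j} \<notin> edges G) \<and>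
        (\<forall>j<2 * i. {y, v j} \<in> edges G \<longleftrightarrow> i = l - 1 \<and> j = 0))}"

text \<open>Only the revealed vertices matter; this lets the set of possible arcs be a function of
  the list of earlier arcs.\<close>

lemma extending_arcs_cong:
  assumes "\<And>j. j < 2 * i \<Longrightarrow> v j = v' j"
  shows "extending_arcs G l i v = extending_arcs G l i v'"
  using assms by (auto simp: extending_arcs_def)

lemma extending_arcs_subset: "extending_arcs G l i v \<subseteq> {(x, y). {x, y} \<in> edges G}"
  by (auto simp: extending_arcs_def)

lemma finite_extending_arcs: "simple_graph G \<Longrightarrow> finite (extending_arcs G l i v)"
  by (rule finite_subset[OF extending_arcs_subset finite_arcs])

lemma cycle_maps_arc_extends:
  assumes w: "w \<in> cycle_maps G (2 * l)" and il: "i < l"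
  shows "(w (2 * int i), w (2 * int i + 1)) \<in> extending_arcs G l i (\<lambda>j. w (int j))"
proof -
  \<comment> \<open>The index differences that occur, also after adding or subtracting 1, lie
    strictly between \<open>- 2 * l\<close> and \<open>2 * l\<close>. The one exception is the
    closing pair \<open>i = l - 1\<close>, \<open>j = 0\<close> of the second vertex, which reaches
    \<open>2 * l\<close>.\<close>
  have z: "int (2 * l) dvd a \<longleftrightarrow> a = 0" if "\<bar>a\<bar> < 2 * int l" for a
    using that zdvd_not_zless[of "\<bar>a\<bar>" "int (2 * l)"] by (auto simp: dvd_abs_iff)
  have e: "{w a, w b} \<in> edges G \<longleftrightarrow> int (2 * l) dvd a - b - 1 \<or> int (2 * l) dvd a - b + 1" for a b
    by (rule cycle_maps_edge_iff[OF w])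
  show ?thesis
    unfolding extending_arcs_def mem_Collect_eq prod.case
  proof (intro conjI impI allI)
    show "{w (2 * int i), w (2 * int i + 1)} \<in> edges G" by (simp add: e)
    assume i: "i > 0"
    then show "{w (2 * int i), w (int (2 * i - 1))} \<in> edges G" by (simp add: e of_nat_diff)
    show "{w (2 * int i), w (int j)} \<notin> edges G" if "j < 2 * i - 1" for j
      using that il by (simp only: e) (subst (1 2) z, auto)
    show "{w (2 * int i + 1), w (int j)} \<in> edges G \<longleftrightarrow> i = l - 1 \<and> j = 0" if "j < 2 * i" for j
    proof (cases "i = l - 1 \<and> j = 0")
      case True
      with il show ?thesis by (simp add: e of_nat_diff)
    next
      case False
      with that il show ?thesis by (simp only: e) (subst (1 2) z, auto)
    qed
  qed
qed

text \<open>This is \<open>p i\<close> of the overview: \<open>w\<close> supplies the revealed path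
  and \<open>w'\<close>, independently, the candidate arc.\<close>

definition extension_prob :: "'a graph \<Rightarrow> nat \<Rightarrow> nat \<Rightarrow> real" where
  "extension_prob G l i = (\<Sum>w\<in>cycle_maps G (2 * l). \<Sum>w'\<in>cycle_maps G (2 * l).
     of_bool ((w' 0, w' 1) \<in> extending_arcs G l i (\<lambda>j. w (int j)))) / real (card (cycle_maps G (2 * l))) ^ 2"


text \<open>Let \<open>q w\<close> be the weight of revealing \<open>w\<close> by successive draws.
  These weights add up to at most 1, so by Jensen the average of \<open>- ln (q w)\<close> is at
  least the logarithm of the number of cycle maps. Expanding \<open>ln (q w)\<close>, Jensen bounds
  the two kinds of terms from the other side: by \<open>ln (2 * m)\<close> per arc and by
  \<open>ln (p i)\<close> per normalizing factor.\<close>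

lemma card_cycle_maps_le_prod:
  fixes G :: "'a graph"
  assumes G: "simple_graph G" and l: "l > 0"
  shows "real (card (cycle_maps G (2 * l))) \<le>
    (2 * real (card (edges G))) ^ l * (\<Prod>i=1..<l. extension_prob G l i)"
proof (cases "cycle_maps G (2 * l) = {}")
  case True
  then show ?thesis by (simp add: prod_nonneg extension_prob_def)
next
  case False
  define W where "W = cycle_maps G (2 * l)"
  define c where "c = real (card W)"
  \<comment> \<open>The law of the first arc of a uniformly random cycle map; by rotation it is the
    law of every \<open>arc i w\<close>.\<close>
  define \<nu> where "\<nu> = (\<lambda>a. real (card {w \<in> W. (w 0, w 1) = a}) / c)"
  define N where "N = (\<lambda>i w. extending_arcs G l i (\<lambda>j. w (int j)))"
  define arc where "arc = (\<lambda>i w. (w (2 * int i), w (2 * int i + 1)) :: 'a \<times> 'a)"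
  have finW: "finite W" unfolding W_def
    by (rule finite_cycle_maps) (use G l in \<open>simp_all add: simple_graph_def\<close>)
  have c: "c > 0" using False finW by (simp add: c_def W_def card_gt_0_iff)
  have \<nu>_nonneg: "\<nu> a \<ge> 0" for a using c by (simp add: \<nu>_def)
  have \<nu>_pos: "\<nu> (arc i w) > 0" if "w \<in> W" for i w
  proof -
    have "(\<lambda>j. w (2 * int i + j)) \<in> {v \<in> W. (v 0, v 1) = arc i w}"
      using cycle_maps_shift[of w G "2 * l" "2 * int i"] that by (simp add: W_def arc_def)
    then have "card {v \<in> W. (v 0, v 1) = arc i w} > 0"
      using finW by (auto simp: card_gt_0_iff simp del: mem_Collect_eq)
    then show ?thesis using c by (simp add: \<nu>_def)
  qed
  have finN: "finite (N i w)" for i w unfolding N_def by (rule finite_extending_arcs[OF G])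
  have arcN: "arc i w \<in> N i w" if "w \<in> W" "i < l" for i w
    using cycle_maps_arc_extends that unfolding arc_def N_def W_def by blast
  have sumN_pos: "sum \<nu> (N i w) > 0" if "w \<in> W" "i < l" for i w
    using sum_mono2[OF finN, of "{arc i w}" i w \<nu>] arcN[OF that] \<nu>_pos[OF that(1), of i] \<nu>_nonneg
    by simp
  have delta: "(\<Sum>a\<in>A. of_bool (b = a)) = (of_bool (b \<in> A) :: real)" if "finite A"
    for A and b :: "'a \<times> 'a" using that by (simp add: of_bool_def)
  have Wpos: "(\<Sum>w\<in>W. f w) > 0" if "\<And>w. w \<in> W \<Longrightarrow> f w > 0" for f :: "(int \<Rightarrow> 'a) \<Rightarrow> real"
    by (rule sum_pos) (use finW False that in \<open>auto simp: W_def\<close>)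
  have Wln: "(\<Sum>w\<in>W. ln (f w)) \<le> c * ln ((\<Sum>w\<in>W. f w) / c)"
    if "\<And>w. w \<in> W \<Longrightarrow> f w > 0" for f :: "(int \<Rightarrow> 'a) \<Rightarrow> real"
    unfolding c_def
    by (rule sum_ln_le_card_mult_ln_mean) (use finW False that in \<open>auto simp: W_def\<close>)
  define m2 where "m2 = 2 * real (card (edges G))"
  have m2: "m2 > 0"
  proof -
    from False obtain w where "w \<in> W" by (auto simp: W_def)
    then have "edges G \<noteq> {}" using arcN[of w 0] l by (auto simp: N_def extending_arcs_def)
    then show ?thesis using finite_edges[OF G] by (simp add: m2_def card_gt_0_iff)
  qed
  \<comment> \<open>The mean of the reciprocal of a probability is the size of the support, here the
    set of arcs that start some cycle map.\<close>
  have inv: "(\<Sum>w\<in>W. 1 / \<nu> (arc 0 w)) \<le> c * m2"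
  proof -
    have "(\<Sum>w\<in>W. 1 / \<nu> (arc 0 w)) = (\<Sum>a\<in>arc 0 ` W. \<Sum>w | w \<in> W \<and> arc 0 w = a. 1 / \<nu> (arc 0 w))"
      by (rule sum.group[symmetric]) (use finW in auto)
    also have "\<dots> = (\<Sum>a\<in>arc 0 ` W. c)"
    proof (rule sum.cong[OF refl])
      fix a assume "a \<in> arc 0 ` W"
      then have "\<nu> a > 0" using \<nu>_pos by auto
      then show "(\<Sum>w | w \<in> W \<and> arc 0 w = a. 1 / \<nu> (arc 0 w)) = c"
        using c by (simp add: \<nu>_def arc_def zero_less_divide_iff)
    qed
    also have "\<dots> = real (card (arc 0 ` W)) * c" by simp
    also have "card (arc 0 ` W) \<le> card {(x, y). {x, y} \<in> edges G}"
    proof (rule card_mono[OF finite_arcs[OF G]])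
      show "arc 0 ` W \<subseteq> {(x, y). {x, y} \<in> edges G}"
      proof (rule image_subsetI)
        fix w assume "w \<in> W"
        then have "arc 0 w \<in> N 0 w" using arcN l by simp
        then show "arc 0 w \<in> {(x, y). {x, y} \<in> edges G}"
          unfolding N_def by (rule subsetD[OF extending_arcs_subset])
      qed
    qed
    also have "\<dots> \<le> 2 * card (edges G)" by (rule card_arcs_le[OF G])
    finally show ?thesis using c by (simp add: m2_def mult.commute)
  qed
  have lnarc: "(\<Sum>w\<in>W. - ln (\<nu> (arc i w))) \<le> c * ln m2" for i
  proof -
    have "(\<Sum>w\<in>W. - ln (\<nu> (arc i w))) = (\<Sum>w\<in>W. - ln (\<nu> (arc 0 w)))"
      using sum_cycle_maps_shift[of "\<lambda>w. - ln (\<nu> (w 0, w 1))" "2 * int i" G "2 * l"]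
      by (simp add: arc_def W_def)
    also have "\<dots> = (\<Sum>w\<in>W. ln (1 / \<nu> (arc 0 w)))"
      by (rule sum.cong) (simp_all add: ln_div \<nu>_pos)
    also have "\<dots> \<le> c * ln ((\<Sum>w\<in>W. 1 / \<nu> (arc 0 w)) / c)"
      by (rule Wln) (use \<nu>_pos in simp)
    also have "\<dots> \<le> c * ln m2"
    proof (intro mult_left_mono ln_mono)
      show "(\<Sum>w\<in>W. 1 / \<nu> (arc 0 w)) / c \<le> m2" using inv c by (simp add: field_simps)
      show "0 < (\<Sum>w\<in>W. 1 / \<nu> (arc 0 w)) / c"
        by (rule divide_pos_pos[OF Wpos c]) (use \<nu>_pos in simp)
    qed (use c in simp)
    finally show ?thesis .
  qed
  \<comment> \<open>The \<nu>-mass of \<open>N i w\<close> is the proportion of second cycles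
    \<open>w'\<close> whose first arc lies in \<open>N i w\<close>.\<close>
  have P: "(\<Sum>w\<in>W. sum \<nu> (N i w)) / c = extension_prob G l i" for i
  proof -
    have "sum \<nu> (N i w) = (\<Sum>w'\<in>W. of_bool ((w' 0, w' 1) \<in> N i w)) / c" for w
    proof -
      have "sum \<nu> (N i w) * c = (\<Sum>a\<in>N i w. \<Sum>w'\<in>W. of_bool ((w' 0, w' 1) = a))"
        using c finW by (simp add: \<nu>_def sum_divide_distrib[symmetric] Int_def)
      also have "\<dots> = (\<Sum>w'\<in>W. \<Sum>a\<in>N i w. of_bool ((w' 0, w' 1) = a))" by (rule sum.swap)
      also have "\<dots> = (\<Sum>w'\<in>W. of_bool ((w' 0, w' 1) \<in> N i w))"
        by (simp only: delta[OF finN])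
      finally show ?thesis using c by (simp add: field_simps)
    qed
    then show ?thesis
      by (simp add: extension_prob_def W_def c_def N_def sum_divide_distrib[symmetric]
          power2_eq_square)
  qed
  have P_pos: "extension_prob G l i > 0" if "i < l" for i
    unfolding P[symmetric] by (rule divide_pos_pos[OF Wpos c]) (use sumN_pos that in blast)
  have lnN: "(\<Sum>w\<in>W. ln (sum \<nu> (N i w))) \<le> c * ln (extension_prob G l i)" if "i < l" for i
    unfolding P[symmetric] by (rule Wln) (use sumN_pos that in blast)
  \<comment> \<open>The denominator starts at \<open>i = 1\<close>: the first arc is drawn with
    weight \<nu> itself, whose mass on \<open>N 0 w\<close> is at most 1.\<close>
  define q where "q = (\<lambda>w. (\<Prod>i<l. \<nu> (arc i w)) / (\<Prod>i=1..<l. sum \<nu> (N i w)))"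
  have q_pos: "q w > 0" if "w \<in> W" for w
    unfolding q_def using that \<nu>_pos sumN_pos by (intro divide_pos_pos prod_pos) auto
  have "(\<Sum>w\<in>W. q w) \<le> 1"
  proof -
    \<comment> \<open>\<open>U w\<close> lists the arcs of \<open>w\<close>; \<open>path\<close>
      reads the vertices back from such a list, which gives the choice sets the form that
      \<open>chain_weight_sum_le_one\<close> expects.\<close>
    define path where "path = (\<lambda>p :: ('a \<times> 'a) list. \<lambda>j. if even j then fst (p ! (j div 2)) else snd (p ! (j div 2)))"
    define U where "U = (\<lambda>w. map (\<lambda>i. arc i w) [0..<l])"
    have U: "length (take i (U w)) = i" "U w ! i = arc i w" if "i < l" for i w
      using that by (simp_all add: U_def)
    have path: "extending_arcs G l i (path (take i (U w))) = N i w" if "i < l" for i w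
      unfolding N_def
    proof (rule extending_arcs_cong)
      fix j assume "j < 2 * i"
      then have "j div 2 < i" by auto
      then have "take i (U w) ! (j div 2) = arc (j div 2) w" using that by (simp add: U_def)
      moreover have "even j \<Longrightarrow> 2 * int (j div 2) = int j" "odd j \<Longrightarrow> 2 * int (j div 2) + 1 = int j"
        by presburger+
      ultimately show "path (take i (U w)) j = w (int j)"
        by (simp add: path_def arc_def)
    qed
    have inj: "inj_on U W"
    proof (rule inj_onI)
      fix w w' assume *: "w \<in> W" "w' \<in> W" "U w = U w'"
      show "w = w'"
      proof (rule cycle_maps_eqI[of _ G "2 * l"])
        fix j :: int assume j: "0 \<le> j" "j < int (2 * l)"
        then have "nat (j div 2) < l" by (simp add: nat_less_iff)
        with *(3) have "arc (nat (j div 2)) w = arc (nat (j div 2)) w'"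
          unfolding U_def by (metis add.left_neutral diff_zero length_map length_upt nth_map nth_upt)
        moreover have "2 * int (nat (j div 2)) = j \<or> 2 * int (nat (j div 2)) + 1 = j"
          using j by (simp add: pos_imp_zdiv_nonneg_iff) presburger
        ultimately show "w j = w' j" unfolding arc_def by (metis prod.inject)
      qed (use * l in \<open>auto simp: W_def\<close>)
    qed
    have sum\<nu>1: "sum \<nu> (N 0 w) \<le> 1" for w
    proof -
      have "(\<Sum>a\<in>N 0 w. \<Sum>w'\<in>W. of_bool ((w' 0, w' 1) = a)) =
          (\<Sum>w'\<in>W. \<Sum>a\<in>N 0 w. of_bool ((w' 0, w' 1) = a) :: real)" by (rule sum.swap)
      also have "\<dots> \<le> (\<Sum>w'\<in>W. 1)"
        by (rule sum_mono) (simp only: delta[OF finN] of_bool_less_eq_one)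
      finally have "sum \<nu> (N 0 w) * c \<le> c"
        using c finW by (simp add: \<nu>_def sum_divide_distrib[symmetric] Int_def c_def)
      then show ?thesis using c by simp
    qed
    have "(\<Sum>w\<in>W. q w) \<le> (\<Sum>w\<in>W. \<Prod>i<l. \<nu> (arc i w) / sum \<nu> (N i w))"
    proof (rule sum_mono)
      fix w assume w: "w \<in> W"
      have "(\<Prod>i<l. sum \<nu> (N i w)) = sum \<nu> (N 0 w) * (\<Prod>i=1..<l. sum \<nu> (N i w))"
        using l by (simp add: lessThan_atLeast0 prod.atLeast_Suc_lessThan)
      also have "\<dots> \<le> 1 * (\<Prod>i=1..<l. sum \<nu> (N i w))"
        using sum\<nu>1 \<nu>_nonneg by (intro mult_right_mono prod_nonneg) (auto intro: sum_nonneg)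
      finally show "q w \<le> (\<Prod>i<l. \<nu> (arc i w) / sum \<nu> (N i w))"
        unfolding q_def prod_dividef using w sumN_pos \<nu>_nonneg
        by (intro divide_left_mono mult_pos_pos prod_pos prod_nonneg) auto
    qed
    also have "\<dots> = (\<Sum>w\<in>W. \<Prod>i<l. \<nu> (U w ! i) /
        sum \<nu> (extending_arcs G l (length (take i (U w))) (path (take i (U w)))))"
      by (intro sum.cong prod.cong refl) (simp only: path U lessThan_iff)
    also have "\<dots> = (\<Sum>u\<in>U ` W. \<Prod>i<l. \<nu> (u ! i) /
        sum \<nu> (extending_arcs G l (length (take i u)) (path (take i u))))"
      by (simp only: sum.reindex[OF inj] o_def)
    also have "\<dots> \<le> 1"
    proof (rule chain_weight_sum_le_one[where N = "\<lambda>p. extending_arcs G l (length p) (path p)"])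
      fix u i assume "u \<in> U ` W" and i: "i < l"
      then obtain w where "w \<in> W" "u = U w" by blast
      with i show "u ! i \<in> extending_arcs G l (length (take i u)) (path (take i u))"
        using arcN[of w i] by (simp only: path U)
    qed (auto simp: finW U_def \<nu>_nonneg finite_extending_arcs[OF G])
    finally show ?thesis .
  qed
  moreover have "(\<Sum>w\<in>W. q w) > 0" by (rule Wpos) (rule q_pos)
  moreover have "(\<Sum>w\<in>W. ln (q w)) \<le> c * ln ((\<Sum>w\<in>W. q w) / c)"
    by (rule Wln) (use q_pos in blast)
  ultimately have "(\<Sum>w\<in>W. ln (q w)) \<le> c * (- ln c)"
    using c by (smt (verit, best) ln_div ln_le_zero_iff mult_left_mono)
  moreover have "ln (q w) = (\<Sum>i<l. ln (\<nu> (arc i w))) - (\<Sum>i=1..<l. ln (sum \<nu> (N i w)))"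
    if "w \<in> W" for w
  proof -
    have "(\<Prod>i<l. \<nu> (arc i w)) > 0" "(\<Prod>i=1..<l. sum \<nu> (N i w)) > 0"
      using that \<nu>_pos sumN_pos by (auto intro!: prod_pos)
    then have "ln (q w) = ln (\<Prod>i<l. \<nu> (arc i w)) - ln (\<Prod>i=1..<l. sum \<nu> (N i w))"
      unfolding q_def by (rule ln_divide_pos)
    also have "ln (\<Prod>i<l. \<nu> (arc i w)) = (\<Sum>i<l. ln (\<nu> (arc i w)))"
      by (intro ln_prod finite_lessThan) (use \<nu>_pos[OF that] less_irrefl in metis)
    also have "ln (\<Prod>i=1..<l. sum \<nu> (N i w)) = (\<Sum>i=1..<l. ln (sum \<nu> (N i w)))"
      by (intro ln_prod finite_atLeastLessThan) (use sumN_pos[OF that] less_irrefl atLeastLessThan_iff in metis)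
    finally show ?thesis .
  qed
  ultimately have "c * ln c \<le> (\<Sum>w\<in>W. (\<Sum>i=1..<l. ln (sum \<nu> (N i w))) - (\<Sum>i<l. ln (\<nu> (arc i w))))"
    by (simp add: sum_subtractf)
  also have "\<dots> = (\<Sum>i=1..<l. \<Sum>w\<in>W. ln (sum \<nu> (N i w))) + (\<Sum>i<l. \<Sum>w\<in>W. - ln (\<nu> (arc i w)))"
    by (simp add: sum_subtractf sum_negf sum.swap[of _ W])
  also have "\<dots> \<le> (\<Sum>i=1..<l. c * ln (extension_prob G l i)) + (\<Sum>i<l. c * ln m2)"
    by (intro add_mono sum_mono lnN lnarc) auto
  also have "\<dots> = c * ((\<Sum>i=1..<l. ln (extension_prob G l i)) + real l * ln m2)"
    by (simp add: sum_distrib_left algebra_simps)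
  finally have "ln c \<le> (\<Sum>i=1..<l. ln (extension_prob G l i)) + real l * ln m2"
    using c by simp
  also have "\<dots> = ln (m2 ^ l * (\<Prod>i=1..<l. extension_prob G l i))"
  proof -
    have "(\<Prod>i=1..<l. extension_prob G l i) > 0" using P_pos by (auto intro: prod_pos)
    then have "ln (m2 ^ l * (\<Prod>i=1..<l. extension_prob G l i)) =
        real l * ln m2 + ln (\<Prod>i=1..<l. extension_prob G l i)"
      using m2 by (subst ln_mult_pos) (simp_all add: ln_realpow)
    also have "ln (\<Prod>i=1..<l. extension_prob G l i) = (\<Sum>i=1..<l. ln (extension_prob G l i))"
      by (intro ln_prod finite_atLeastLessThan) (use P_pos less_irrefl atLeastLessThan_iff in metis)
    finally show ?thesis by simp
  qed
  finally have *: "ln c \<le> ln (m2 ^ l * (\<Prod>i=1..<l. extension_prob G l i))" .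
  have "m2 ^ l * (\<Prod>i=1..<l. extension_prob G l i) > 0"
    using m2 P_pos by (intro mult_pos_pos prod_pos) auto
  with * c show ?thesis by (simp add: c_def m2_def W_def)
qed

section \<open>Cycles of length at least 8\<close>

lemma card_periodic_shift:
  fixes R :: "int \<Rightarrow> bool"
  assumes n: "n > 0" and per: "\<And>x. R (x + n) = R x"
  shows "card {x \<in> {0..<n}. R (x + 1)} = card {x \<in> {0..<n}. R x}"
proof -
  have "bij_betw (\<lambda>x. if x = n - 1 then 0 else x + 1) {x \<in> {0..<n}. R (x + 1)} {x \<in> {0..<n}. R x}"
    using n per[of 0] per[of "-1"]
    by (intro bij_betw_byWitness[where f' = "\<lambda>x. if x = 0 then n - 1 else x - 1"]) auto
  then show ?thesis by (rule bij_betw_same_card)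
qed

lemma periodic_mod:
  fixes R :: "int \<Rightarrow> bool"
  assumes per: "\<And>x. R (x + n) = R x"
  shows "R (x mod n) = R x"
proof -
  have 1: "R (y + n * int k) = R y" for y k
  proof (induction k)
    case (Suc k)
    then show ?case using per[of "y + n * int k"] by (simp add: algebra_simps)
  qed simp
  have "R (y + n * k) = R y" for y k
  proof (cases k)
    case (nonneg m)
    then show ?thesis using 1 by simp
  next
    case (neg m)
    have "y + n * k + n * int (Suc m) = y" unfolding neg by (simp only: mult_minus_right diff_add_cancel add_uminus_conv_diff)
    with 1[of "y + n * k" "Suc m"] show ?thesis by (simp only:)
  qed
  from this[of "x mod n" "x div n"] show ?thesis by simp
qed

text \<open>\<open>T\<close> marks vertices of a cycle of even length \<open>n\<close>. Two consecutive vertices cannot both have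
  their first marked vertex at odd distance, so at most half of them do. A \<open>long_gap\<close> is unique, and it
  creates two vertices that take part in no such pair.\<close>

definition odd_gap :: "(int \<Rightarrow> bool) \<Rightarrow> int \<Rightarrow> bool" where
  "odd_gap T s \<longleftrightarrow> (\<exists>d>0. odd d \<and> T (s + d) \<and> (\<forall>j\<in>{0..<d}. \<not> T (s + j)))"

text \<open>For \<open>n = 2 * l\<close>, the offset \<open>n - 3\<close> is the index
  \<open>2 * (l - 1) - 1\<close> of the last revealed vertex before the final arc: that arc touches
  the path exactly at its two ends.\<close>

definition long_gap :: "int \<Rightarrow> (int \<Rightarrow> bool) \<Rightarrow> int \<Rightarrow> bool" where
  "long_gap n T s \<longleftrightarrow> T s \<and> T (s + (n - 3)) \<and> (\<forall>j\<in>{0<..<n - 3}. \<not> T (s + j))"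

lemma odd_gap_iff:
  assumes "T (s + d)" "d \<ge> 0" "\<And>j. 0 \<le> j \<Longrightarrow> j < d \<Longrightarrow> \<not> T (s + j)"
  shows "odd_gap T s \<longleftrightarrow> odd d"
proof
  assume "odd_gap T s"
  then obtain d' where d': "d' > 0" "odd d'" "T (s + d')" "\<forall>j\<in>{0..<d'}. \<not> T (s + j)"
    by (auto simp: odd_gap_def)
  have "d' = d"
    using assms d' by (metis atLeastLessThan_iff less_imp_le linorder_neqE)
  with d' show "odd d" by simp
next
  assume "odd d"
  moreover from this have "d \<noteq> 0" by auto
  ultimately show "odd_gap T s" unfolding odd_gap_def
    using assms by (intro exI[of _ d]) auto
qed

lemma card_gaps_le:
  fixes T :: "int \<Rightarrow> bool"
  assumes l: "l \<ge> 4" and per: "\<And>x. T (x + 2 * l) = T x"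
  shows "card {s \<in> {0..<2 * l}. odd_gap T s} + card {s \<in> {0..<2 * l}. long_gap (2 * l) T s} \<le> nat l"
proof -
  define n where "n = 2 * l"
  define R where "R = odd_gap T"
  have n: "n \<ge> 8" using l by (simp add: n_def)
  have per: "T (x + n) = T x" for x using per by (simp add: n_def)
  have Rper: "R (x + n) = R x" for x
  proof -
    have "T (x + n + j) = T (x + j)" for j using per[of "x + j"] by (simp add: algebra_simps)
    then show ?thesis by (simp add: R_def odd_gap_def)
  qed
  have notT: "\<not> T s" if "R s" for s
    using that unfolding R_def odd_gap_def by (metis add.right_neutral atLeastLessThan_iff order_refl)
  have disj: "\<not> R (s + 1)" if "R s" for s
  proof
    assume R1: "R (s + 1)"
    then obtain d where d: "d > 0" "odd d" "T (s + 1 + d)" "\<forall>j\<in>{0..<d}. \<not> T (s + 1 + j)"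
      by (auto simp: R_def odd_gap_def)
    have "\<not> T (s + j)" if "0 \<le> j" "j < d + 1" for j
      using d(4) notT[OF \<open>R s\<close>] that
      by (cases "j = 0") (auto dest: bspec[of _ _ "j - 1"] simp: algebra_simps)
    then have "odd_gap T s \<longleftrightarrow> odd (d + 1)"
      using d by (intro odd_gap_iff) (auto simp: algebra_simps)
    with that d show False by (simp add: R_def)
  qed
  define RR where "RR = {s \<in> {0..<n}. R s}"
  \<comment> \<open>As \<open>R s\<close> excludes \<open>R (s + 1)\<close>, one period splits into
    \<open>RR\<close>, its translate \<open>R1\<close> and \<open>Z\<close>, so
    \<open>2 * card RR + card Z = n\<close>. Two elements of \<open>Z\<close> therefore pay for one
    long gap.\<close>
  define Z where "Z = {s \<in> {0..<n}. \<not> R s \<and> \<not> R (s + 1)}"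
  define R1 where "R1 = {s \<in> {0..<n}. R (s + 1)}"
  have fin: "finite RR" "finite R1" "finite Z"
    unfolding RR_def R1_def Z_def by (rule finite_subset[of _ "{0..<n}"]; auto)+
  moreover have "RR \<inter> R1 = {}" "(RR \<union> R1) \<inter> Z = {}" using disj by (auto simp: RR_def R1_def Z_def)
  ultimately have "card (RR \<union> R1 \<union> Z) = card RR + card R1 + card Z"
    by (simp add: card_Un_disjoint)
  moreover have "RR \<union> R1 \<union> Z = {0..<n}" by (auto simp: RR_def R1_def Z_def)
  moreover have "card R1 = card RR"
    unfolding RR_def R1_def by (rule card_periodic_shift) (use n Rper in auto)
  ultimately have count: "2 * card RR + card Z = nat n" by simp
  have Zmod: "x mod n \<in> Z" if "\<not> R x" "\<not> R (x + 1)" for x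
    using that periodic_mod[of R n x] periodic_mod[of "\<lambda>x. R (x + 1)" n x] Rper[of "x + 1" for x] n Rper
    by (simp add: Z_def algebra_simps)
  define F where "F = {s \<in> {0..<n}. long_gap n T s}"
  \<comment> \<open>Two long gaps would put both cyclic distances between their starts at
    \<open>n - 3\<close> or more, so \<open>2 * (n - 3) <= n\<close>. This is impossible for
    \<open>n > 6\<close> and is where 6-cycles differ.\<close>
  have F1: "card F \<le> 1"
  proof -
    have "\<not> s < s'" if "s \<in> F" "s' \<in> F" for s s'
    proof
      assume lt: "s < s'"
      have *: "\<forall>j\<in>{0<..<n - 3}. \<not> T (s + j)" "\<forall>j\<in>{0<..<n - 3}. \<not> T (s' + j)"
        "T s" "T s'" "s' < n" "0 \<le> s"
        using that by (auto simp: F_def long_gap_def)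
      have "s' - s \<ge> n - 3"
        by (rule ccontr) (use bspec[OF *(1), of "s' - s"] lt *(4) in auto)
      moreover have "s + n - s' \<ge> n - 3"
        by (rule ccontr) (use bspec[OF *(2), of "s + n - s'"] lt *(3,5,6) per[of s] in auto)
      ultimately show False using n by linarith
    qed
    then have "s = s'" if "s \<in> F" "s' \<in> F" for s s' using that by (meson linorder_neqE)
    moreover have "finite F" by (rule finite_subset[of _ "{0..<n}"]) (auto simp: F_def)
    ultimately show ?thesis by (simp add: card_le_Suc0_iff_eq)
  qed
  \<comment> \<open>The start \<open>s\<close> is marked and the next mark lies at the even distance
    \<open>n - 4\<close> from \<open>s + 1\<close>, so \<open>s\<close> is in \<open>Z\<close>. The
    gap ends at \<open>s - 3\<close> modulo \<open>n\<close>. If \<open>R (s - 1)\<close> fails,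
    \<open>s - 1\<close> is a second element. Otherwise \<open>R (s - 2)\<close> fails by
    \<open>disj\<close> and \<open>R (s - 3)\<close> fails because \<open>s - 3\<close> is marked,
    so \<open>s - 3\<close> is one.\<close>
  have F2: "card Z \<ge> 2" if "F \<noteq> {}"
  proof -
    from that obtain s where s: "0 \<le> s" "s < n" "T s" "T (s + (n - 3))"
      and gap: "\<And>j. 0 < j \<Longrightarrow> j < n - 3 \<Longrightarrow> \<not> T (s + j)"
      by (auto simp: F_def long_gap_def)
    have "\<not> T (s + 1 + j)" if "0 \<le> j" "j < n - 4" for j
      using gap[of "1 + j"] that by (simp add: add.assoc)
    then have "odd_gap T (s + 1) \<longleftrightarrow> odd (n - 4)"
      using s n by (intro odd_gap_iff) (auto simp: algebra_simps)
    then have s1: "\<not> R (s + 1)" by (simp add: R_def n_def)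
    have s0: "\<not> R s" using notT s by auto
    have z0: "s \<in> Z" using s s0 s1 by (simp add: Z_def)
    have "\<exists>x\<in>{s - 1, s - 3}. \<not> R x \<and> \<not> R (x + 1)"
    proof (cases "R (s - 1)")
      case True
      have T3: "T (s - 3)" using s(4) per[of "s - 3"] by (simp add: algebra_simps)
      have "\<not> R (s - 2)"
      proof
        assume "R (s - 2)"
        from disj[OF this] True show False by simp
      qed
      then show ?thesis using notT[of "s - 3"] T3 by auto
    qed (use s0 in auto)
    then obtain x where x: "x \<in> {s - 1, s - 3}" "\<not> R x" "\<not> R (x + 1)" by blast
    have "x mod n \<noteq> s"
    proof
      assume "x mod n = s"
      then have "x mod n = s mod n" using s by simp
      then have "n dvd x - s" by (simp add: mod_eq_dvd_iff)
      then have "n dvd 1 \<or> n dvd 3" using x(1) by auto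
      then show False using zdvd_imp_le[of n 1] zdvd_imp_le[of n 3] n by auto
    qed
    then have "card {s, x mod n} = 2" by simp
    moreover have "{s, x mod n} \<subseteq> Z" using z0 Zmod[OF x(2,3)] by simp
    ultimately show ?thesis using card_mono[OF fin(3), of "{s, x mod n}"] by simp
  qed
  have "nat n = 2 * nat l" using l by (simp add: n_def nat_mult_distrib)
  with count F1 F2 have "card RR + card F \<le> nat l"
    by (cases "F = {}") auto
  then show ?thesis by (simp add: RR_def F_def R_def n_def)
qed

text \<open>\<open>extends_at A B\<close> is membership in \<^const>\<open>extending_arcs\<close> for the arc whose ends have neighbourhoods
  \<open>A\<close> and \<open>B\<close> on the cycle, the path starting at \<open>s\<close>.\<close>

definition extends_at :: "nat \<Rightarrow> (int \<Rightarrow> bool) \<Rightarrow> (int \<Rightarrow> bool) \<Rightarrow> int \<Rightarrow> nat \<Rightarrow> bool" where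
  "extends_at l A B s i \<longleftrightarrow> A (s + int (2 * i - 1)) \<and> (\<forall>j<2 * i - 1. \<not> A (s + int j)) \<and>
     (\<forall>j<2 * i. B (s + int j) \<longleftrightarrow> i = l - 1 \<and> j = 0)"

lemma extending_arcs_iff_extends_at:
  assumes "i > 0"
  shows "(x, y) \<in> extending_arcs G l i (\<lambda>j. w (s + int j)) \<longleftrightarrow> {x, y} \<in> edges G \<and>
    extends_at l (\<lambda>j. {x, w j} \<in> edges G) (\<lambda>j. {y, w j} \<in> edges G) s i"
  using assms by (simp add: extending_arcs_def extends_at_def)

text \<open>Mark the vertices adjacent to an end of the arc. Extending in a step
  \<open>i < l - 1\<close> puts the first mark at the odd distance \<open>2 * i - 1\<close> from
  \<open>s\<close>, which determines \<open>i\<close>; extending in the last step needs a long gap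
  at \<open>s\<close>. So \<open>card_gaps_le\<close> applies.\<close>

lemma sum_extends_at_le:
  assumes l: "l \<ge> 4" and A: "\<And>x. A (x + 2 * int l) = A x" and B: "\<And>x. B (x + 2 * int l) = B x"
  shows "(\<Sum>s\<in>{0..<2 * int l}. \<Sum>i=1..<l. of_bool (extends_at l A B s i) + of_bool (extends_at l B A s i)) \<le> l"
proof -
  define T where "T = (\<lambda>x. A x \<or> B x)"
  define h where "h = (\<lambda>s i. extends_at l A B s i \<or> extends_at l B A s i)"
  \<comment> \<open>The two orientations contradict each other at \<open>s + (2 * i - 1)\<close>:
    one wants \<open>A\<close> to hold there, the other wants it to fail.\<close>
  have excl: "of_bool (extends_at l A B s i) + of_bool (extends_at l B A s i) = (of_bool (h s i) :: nat)"
    if "i \<in> {1..<l}" for s i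
  proof -
    have "\<not> (extends_at l A B s i \<and> extends_at l B A s i)"
    proof clarify
      assume "extends_at l A B s i" "extends_at l B A s i"
      then have "A (s + int (2 * i - 1))" "\<forall>j<2 * i. A (s + int j) \<longleftrightarrow> i = l - 1 \<and> j = 0"
        unfolding extends_at_def by blast+
      then show False using that by (auto dest!: spec[of _ "2 * i - 1"])
    qed
    then show ?thesis by (auto simp: h_def)
  qed
  have last: "long_gap (2 * int l) T s" if "h s (l - 1)" for s
  proof -
    have e: "int (2 * (l - 1) - 1) = 2 * int l - 3" using l by (simp add: of_nat_diff)
    have "T s \<and> T (s + (2 * int l - 3)) \<and> (\<forall>j<2 * (l - 1) - 1. 0 < j \<longrightarrow> \<not> T (s + int j))"
      using that l unfolding h_def extends_at_def T_def e by force
    moreover have "\<not> T (s + j)" if "j \<in> {0<..<2 * int l - 3}" for j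
      using calculation that by (auto dest!: spec[of _ "nat j"])
    ultimately show ?thesis unfolding long_gap_def by blast
  qed
  have first: "T (s + int (2 * i - 1)) \<and> (\<forall>j<2 * i - 1. \<not> T (s + int j))"
    if "h s i" "i \<in> {1..<l - 1}" for s i
    using that unfolding h_def extends_at_def T_def by auto
  have regular: "(\<Sum>i=1..<l - 1. of_bool (h s i)) \<le> (of_bool (odd_gap T s) :: nat)" for s
  proof (cases "\<exists>i\<in>{1..<l - 1}. h s i")
    case True
    then obtain i where i: "i \<in> {1..<l - 1}" "h s i" by blast
    have "i' = i" if "i' \<in> {1..<l - 1}" "h s i'" for i'
    proof -
      have "2 * i' - 1 = 2 * i - 1"
        using first[OF i(2,1)] first[OF that(2,1)] by (metis linorder_neqE)
      with i that show ?thesis by auto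
    qed
    then have "{i' \<in> {1..<l - 1}. h s i'} \<subseteq> {i}" by blast
    then have "card {i' \<in> {1..<l - 1}. h s i'} \<le> 1" using card_mono[of "{i}"] by simp
    moreover have "odd_gap T s"
    proof -
      have "\<not> T (s + j)" if "0 \<le> j" "j < int (2 * i - 1)" for j
        using first[OF i(2,1)] that by (auto dest!: spec[of _ "nat j"])
      then have "odd_gap T s \<longleftrightarrow> odd (int (2 * i - 1))"
        using first[OF i(2,1)] by (intro odd_gap_iff) auto
      then show ?thesis using i by simp
    qed
    ultimately show ?thesis by (simp add: Int_def)
  next
    case False
    then show ?thesis by simp
  qed
  have "(\<Sum>s\<in>{0..<2 * int l}. \<Sum>i=1..<l. of_bool (extends_at l A B s i) + of_bool (extends_at l B A s i)) =
      (\<Sum>s\<in>{0..<2 * int l}. \<Sum>i=1..<l. (of_bool (h s i) :: nat))"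
    by (intro sum.cong refl excl) auto
  also have "\<dots> \<le> (\<Sum>s\<in>{0..<2 * int l}. of_bool (odd_gap T s) + of_bool (long_gap (2 * int l) T s))"
  proof (rule sum_mono)
    fix s
    have "{1..<l} = insert (l - 1) {1..<l - 1}" using l by auto
    then have "(\<Sum>i=1..<l. of_bool (h s i)) = (of_bool (h s (l - 1)) :: nat) + (\<Sum>i=1..<l - 1. of_bool (h s i))"
      by simp
    moreover have "of_bool (h s (l - 1)) \<le> (of_bool (long_gap (2 * int l) T s) :: nat)"
      using last by simp
    ultimately show "(\<Sum>i=1..<l. (of_bool (h s i) :: nat)) \<le> of_bool (odd_gap T s) + of_bool (long_gap (2 * int l) T s)"
      using regular[of s] by linarith
  qed
  also have "\<dots> = card {s \<in> {0..<2 * int l}. odd_gap T s} + card {s \<in> {0..<2 * int l}. long_gap (2 * int l) T s}"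
    by (simp add: sum.distrib Int_def)
  also have "\<dots> \<le> nat (int l)"
    by (rule card_gaps_le) (use l A B in \<open>auto simp: T_def\<close>)
  finally show ?thesis by simp
qed

section \<open>Cycles of length 6\<close>

text \<open>\<open>A\<close> and \<open>B\<close> are the neighbourhoods, on a 6-cycle, of the two ends of an edge.\<close>

definition antipodal_pair :: "(int \<Rightarrow> bool) \<Rightarrow> (int \<Rightarrow> bool) \<Rightarrow> int \<Rightarrow> bool" where
  "antipodal_pair A B t \<longleftrightarrow> (\<forall>i. (A i \<longleftrightarrow> 6 dvd i - t) \<and> (B i \<longleftrightarrow> 6 dvd i - t - 3))"

text \<open>Step 1 for \<open>l = 3\<close> asks for exactly one adjacency between the arc and the
  cycle edge \<open>s, s + 1\<close>, at a prescribed one of four places. Forgetting the place makes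
  the relation symmetric in the two cycles.\<close>

definition single_contact :: "(int \<Rightarrow> bool) \<Rightarrow> (int \<Rightarrow> bool) \<Rightarrow> int \<Rightarrow> bool" where
  "single_contact A B s \<longleftrightarrow>
     of_bool (A s) + of_bool (A (s + 1)) + of_bool (B s) + of_bool (B (s + 1)) = (1::nat)"

text \<open>Modulo 6 the only mark of \<open>B\<close> is \<open>t + 3\<close>, and it is also
  \<open>t'\<close>. Along consecutive antipodal pairs the marks thus alternate between
  \<open>t\<close> and \<open>t + 3\<close>.\<close>

lemma antipodal_pair_chain:
  assumes "antipodal_pair A B t" "antipodal_pair B C t'"
  shows "antipodal_pair B C (t + 3)"
proof -
  have "6 dvd i - t - 3 \<longleftrightarrow> 6 dvd i - t'" for i using assms by (simp add: antipodal_pair_def)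
  from this[of "t + 3"] have "6 dvd t + 3 - t'" by simp
  then have "6 dvd i - t' \<longleftrightarrow> 6 dvd i - (t + 3)" "6 dvd i - t' - 3 \<longleftrightarrow> 6 dvd i - (t + 3) - 3" for i
    by presburger+
  then show ?thesis using assms(2) by (simp add: antipodal_pair_def)
qed

lemma antipodal_pair_unique:
  assumes "antipodal_pair A B t"
  shows "A i \<Longrightarrow> A j \<Longrightarrow> 6 dvd i - j" "B i \<Longrightarrow> B j \<Longrightarrow> 6 dvd i - j" "\<exists>i. A i" "\<exists>i. B i"
proof -
  show "A i \<Longrightarrow> A j \<Longrightarrow> 6 dvd i - j" "B i \<Longrightarrow> B j \<Longrightarrow> 6 dvd i - j"
    using assms unfolding antipodal_pair_def by (simp, presburger)+
  have "A t" "B (t + 3)" using assms by (simp_all add: antipodal_pair_def)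
  then show "\<exists>i. A i" "\<exists>i. B i" by blast+
qed

lemma sum_upto_6: "(\<Sum>s\<in>{0..<6::int}. f s) = f 0 + f 1 + f 2 + f 3 + f 4 + f 5"
  for f :: "int \<Rightarrow> 'b :: comm_monoid_add"
proof -
  have "{0..<6::int} = {0, 1, 2, 3, 4, 5}" by auto
  then show ?thesis by (simp add: add.assoc)
qed

lemma card_two_residues: "card {i \<in> {0..<6::int}. 6 dvd i - a \<or> 6 dvd i - b} \<le> 2"
proof -
  have "{i \<in> {0..<6::int}. 6 dvd i - a \<or> 6 dvd i - b} \<subseteq> {a mod 6, b mod 6}"
    by (auto simp: mod_eq_dvd_iff[symmetric])
  from card_mono[OF _ this] show ?thesis by (simp add: card_insert_if split: if_splits)
qed

text \<open>\<open>M i j\<close> stands for adjacency of vertex \<open>i\<close> of one 6-cycle and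
  vertex \<open>j\<close> of another. A row pair counted by \<open>q\<close> needs exactly one mark
  modulo 6 in each of its rows. Many antipodal column pairs concentrate the marks, and rows that are
  empty or have two marks are blocked.\<close>

lemma antipodal_columns_block_rows:
  fixes M :: "int \<Rightarrow> int \<Rightarrow> bool"
  defines "p \<equiv> \<lambda>j. \<exists>t. antipodal_pair (\<lambda>i. M i j) (\<lambda>i. M i (j + 1)) t"
    and "q \<equiv> \<lambda>i. \<exists>u. antipodal_pair (M i) (M (i + 1)) u"
  assumes per: "\<And>i j. M i (j + 6) = M i j"
    and many: "card {j \<in> {0..<6}. p j} \<ge> 4"
  shows "card {j \<in> {0..<6}. p j} + card {i \<in> {0..<6}. q i} \<le> 6"
proof -
  have chain: "antipodal_pair (\<lambda>i. M i (j + 1)) (\<lambda>i. M i (j + 2)) (t + 3)"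
    if "antipodal_pair (\<lambda>i. M i j) (\<lambda>i. M i (j + 1)) t" "p (j + 1)" for j t
    using that antipodal_pair_chain unfolding p_def by (auto simp: add.assoc)
  have pper: "p (j + 6) = p j" for j
    using per[of _ j] per[of _ "j + 1"] by (simp add: p_def algebra_simps)
  have card_p: "card {j \<in> {0..<6}. p j} = of_bool (p 0) + of_bool (p 1) + of_bool (p 2) +
      of_bool (p 3) + of_bool (p 4) + of_bool (p 5)"
    using sum_upto_6[of "\<lambda>j. of_bool (p j) :: nat"] by (simp add: Int_def)
  have p6: "p 6 = p 0" "p 7 = p 1" "p 8 = p 2" "p 9 = p 3" "p 10 = p 4"
    using pper[of 0] pper[of 1] pper[of 2] pper[of 3] pper[of 4] by simp_all
  have q_row: "6 dvd j - j'" if "q i \<or> q (i - 1)" "M i j" "M i j'" for i j j'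
    using that(1)
  proof
    assume "q i"
    then show ?thesis using antipodal_pair_unique(1) that(2,3) unfolding q_def by blast
  next
    assume "q (i - 1)"
    then obtain u where "antipodal_pair (M (i - 1)) (M i) u" unfolding q_def by auto
    from antipodal_pair_unique(2)[OF this that(2,3)] show ?thesis .
  qed
  have q_ne: "(\<exists>j. M i j) \<and> (\<exists>j. M (i + 1) j)" if "q i" for i
    using that antipodal_pair_unique(3,4) unfolding q_def by blast
  have row: "M i j \<or> M i (j + 1) \<or> M i (j + 2) \<or> M i (j + 3) \<or> M i (j + 4) \<or> M i (j + 5)"
    if "M i x" for i j x
  proof -
    have "M i (j + (x - j) mod 6)"
      using periodic_mod[of "\<lambda>a. M i (j + a)" 6 "x - j"] per[of i "j + a" for a] that
      by (simp add: add.assoc)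
    moreover have "(x - j) mod 6 \<in> {0, 1, 2, 3, 4, 5}" by auto
    ultimately show ?thesis by auto
  qed
  show ?thesis
  proof (cases "card {j \<in> {0..<6}. p j} \<ge> 5")
    case True
    \<comment> \<open>At most one position is missing, so five in a row are present. Then all marks
      lie in the rows \<open>t\<close> and \<open>t + 3\<close>, and no two adjacent rows are both
      nonempty.\<close>
    have "\<exists>j. p j \<and> p (j + 1) \<and> p (j + 2) \<and> p (j + 3) \<and> p (j + 4)"
    proof (rule ccontr)
      assume "\<nexists>j. p j \<and> p (j + 1) \<and> p (j + 2) \<and> p (j + 3) \<and> p (j + 4)"
      then have "\<not> (p j \<and> p (j + 1) \<and> p (j + 2) \<and> p (j + 3) \<and> p (j + 4))" for j by blast
      from this[of 0] this[of 1] this[of 2] this[of 3] this[of 4] this[of 5] True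
      show False unfolding card_p
        by (cases "p 0"; cases "p 1"; cases "p 2"; cases "p 3"; cases "p 4"; cases "p 5") (simp_all add: p6)
    qed
    then obtain j where j: "p j" "p (j + 1)" "p (j + 2)" "p (j + 3)" "p (j + 4)" by blast
    then obtain t where t: "antipodal_pair (\<lambda>i. M i j) (\<lambda>i. M i (j + 1)) t" by (auto simp: p_def)
    have t1: "antipodal_pair (\<lambda>i. M i (j + 1)) (\<lambda>i. M i (j + 2)) (t + 3)" using chain[OF t j(2)] .
    have t2: "antipodal_pair (\<lambda>i. M i (j + 2)) (\<lambda>i. M i (j + 3)) (t + 6)"
      using chain[of "j + 1" "t + 3"] t1 j by (simp add: add.assoc)
    have t3: "antipodal_pair (\<lambda>i. M i (j + 3)) (\<lambda>i. M i (j + 4)) (t + 9)"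
      using chain[of "j + 2" "t + 6"] t2 j by (simp add: add.assoc)
    have t4: "antipodal_pair (\<lambda>i. M i (j + 4)) (\<lambda>i. M i (j + 5)) (t + 12)"
      using chain[of "j + 3" "t + 9"] t3 j by (simp add: add.assoc)
    have "\<not> q i" for i
    proof
      assume q: "q i"
      have "6 dvd i - t \<or> 6 dvd i - t - 3" if x: "M i x" for i x
      proof -
        have "6 dvd i - (t + 6) \<longleftrightarrow> 6 dvd i - t" "6 dvd i - (t + 6) - 3 \<longleftrightarrow> 6 dvd i - t - 3"
          "6 dvd i - (t + 12) \<longleftrightarrow> 6 dvd i - t" "6 dvd i - (t + 12) - 3 \<longleftrightarrow> 6 dvd i - t - 3"
          by presburger+
        with row[OF x, of j] show ?thesis using t t2 t4 unfolding antipodal_pair_def by auto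
      qed
      with q_ne[OF q] have "6 dvd i - t \<or> 6 dvd i - t - 3" "6 dvd i + 1 - t \<or> 6 dvd i + 1 - t - 3"
        by blast+
      then show False by presburger
    qed
    then have "card {i \<in> {0..<6}. q i} = 0" by simp
    moreover have "card {j \<in> {0..<6}. p j} \<le> 6" unfolding card_p by simp
    ultimately show ?thesis by simp
  next
    case False
    \<comment> \<open>Exactly four positions are present. Either three of them are consecutive, or
      the two missing ones are opposite. Both cases leave two residues for \<open>q\<close>, and
      \<open>4 + 2 = 6\<close>.\<close>
    have "\<exists>a b. \<forall>i. q i \<longrightarrow> 6 dvd i - a \<or> 6 dvd i - b"
    proof (cases "\<exists>j. p j \<and> p (j + 1) \<and> p (j + 2)")
      case True
      then obtain j where j: "p j" "p (j + 1)" "p (j + 2)" by blast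
      then obtain t where t: "antipodal_pair (\<lambda>i. M i j) (\<lambda>i. M i (j + 1)) t" by (auto simp: p_def)
      have t1: "antipodal_pair (\<lambda>i. M i (j + 1)) (\<lambda>i. M i (j + 2)) (t + 3)" using chain[OF t j(2)] .
      have t2: "antipodal_pair (\<lambda>i. M i (j + 2)) (\<lambda>i. M i (j + 3)) (t + 6)"
        using chain[of "j + 1" "t + 3"] t1 j by (simp add: add.assoc)
      \<comment> \<open>Columns \<open>j\<close> to \<open>j + 3\<close> are marked alternately in
        rows \<open>t\<close> and \<open>t + 3\<close>, so each of these rows has two marks.\<close>
      have no: "\<not> q i \<and> \<not> q (i - 1)" if "6 dvd i - t \<or> 6 dvd i - t - 3" for i
      proof -
        from that have "M i j \<and> M i (j + 2) \<or> M i (j + 1) \<and> M i (j + 3)"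
        proof
          assume "6 dvd i - t"
          then have "6 dvd i - (t + 6)" by presburger
          with \<open>6 dvd i - t\<close> show ?thesis using t t2 by (simp add: antipodal_pair_def)
        next
          assume "6 dvd i - t - 3"
          then have "6 dvd i - (t + 3)" "6 dvd i - (t + 6) - 3" by presburger+
          then show ?thesis using t1 t2 by (simp add: antipodal_pair_def)
        qed
        then show ?thesis
          using q_row[of i j "j + 2"] q_row[of i "j + 1" "j + 3"] by auto
      qed
      have "6 dvd i - (t + 1) \<or> 6 dvd i - (t + 4)" if "q i" for i
      proof -
        have "\<not> (6 dvd i - t \<or> 6 dvd i - t - 3)" "\<not> (6 dvd i + 1 - t \<or> 6 dvd i + 1 - t - 3)"
          using no[of i] no[of "i + 1"] that by auto
        then show ?thesis by presburger
      qed
      then show ?thesis by blast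
    next
      case no3: False
      have "\<exists>j. p j \<and> p (j + 1) \<and> p (j + 3) \<and> p (j + 4)"
      proof (rule ccontr)
        assume "\<nexists>j. p j \<and> p (j + 1) \<and> p (j + 3) \<and> p (j + 4)"
        with no3 have "\<not> (p j \<and> p (j + 1) \<and> p (j + 2)) \<and> \<not> (p j \<and> p (j + 1) \<and> p (j + 3) \<and> p (j + 4))" for j
          by blast
        from this[of 0] this[of 1] this[of 2] this[of 3] this[of 4] this[of 5] many
        show False unfolding card_p
          by (cases "p 0"; cases "p 1"; cases "p 2"; cases "p 3"; cases "p 4"; cases "p 5") (simp_all add: p6)
      qed
      then obtain j where j: "p j" "p (j + 1)" "p (j + 3)" "p (j + 4)" by blast
      then obtain t u where t: "antipodal_pair (\<lambda>i. M i j) (\<lambda>i. M i (j + 1)) t"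
        and u: "antipodal_pair (\<lambda>i. M i (j + 3)) (\<lambda>i. M i (j + 4)) u"
        unfolding p_def by (auto simp: add.assoc)
      have t1: "antipodal_pair (\<lambda>i. M i (j + 1)) (\<lambda>i. M i (j + 2)) (t + 3)" using chain[OF t j(2)] .
      have u1: "antipodal_pair (\<lambda>i. M i (j + 4)) (\<lambda>i. M i (j + 5)) (u + 3)"
        using chain[of "j + 3" u] u j by (simp add: add.assoc)
      \<comment> \<open>All six columns are known: row \<open>t\<close> has marks at
        \<open>j, j + 2\<close>, row \<open>u\<close> at \<open>j + 3, j + 5\<close>, and the other
        two columns are marked in rows \<open>t + 3\<close> and \<open>u + 3\<close>, the only ones
        left for \<open>q\<close>.\<close>
      have no: "\<not> q i \<and> \<not> q (i - 1)" if "6 dvd i - t \<or> 6 dvd i - u" for i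
      proof -
        have "6 dvd i - (t + 3) - 3 \<longleftrightarrow> 6 dvd i - t" "6 dvd i - (u + 3) - 3 \<longleftrightarrow> 6 dvd i - u"
          by presburger+
        with that have "M i j \<and> M i (j + 2) \<or> M i (j + 3) \<and> M i (j + 5)"
          using t t1 u u1 by (simp add: antipodal_pair_def)
        then show ?thesis
          using q_row[of i j "j + 2"] q_row[of i "j + 3" "j + 5"] by auto
      qed
      have "6 dvd i - (t + 3) \<or> 6 dvd i - (u + 3)" if q: "q i" for i
      proof -
        from q_ne[OF q] obtain x where "M i x" by blast
        from row[OF this, of j]
        have "6 dvd i - t \<or> 6 dvd i - t - 3 \<or> 6 dvd i - (t + 3) - 3 \<or>
            6 dvd i - u \<or> 6 dvd i - u - 3 \<or> 6 dvd i - (u + 3) - 3"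
          using t t1 u u1 unfolding antipodal_pair_def by auto
        moreover have "\<not> (6 dvd i - t \<or> 6 dvd i - u)" using no[of i] q by blast
        ultimately show ?thesis by presburger
      qed
      then show ?thesis by blast
    qed
    then obtain a b where "\<And>i. q i \<Longrightarrow> 6 dvd i - a \<or> 6 dvd i - b" by blast
    then have sub: "{i \<in> {0..<6}. q i} \<subseteq> {i \<in> {0..<6}. 6 dvd i - a \<or> 6 dvd i - b}" by blast
    have "finite {i \<in> {0..<6}. 6 dvd i - a \<or> 6 dvd i - b}"
      by (rule finite_subset[of _ "{0..<6}"]) auto
    from card_mono[OF this sub] have "card {i \<in> {0..<6}. q i} \<le> card {i \<in> {0..<6}. 6 dvd i - a \<or> 6 dvd i - b}" .
    with card_two_residues[of a b] False show ?thesis by linarith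
  qed
qed

text \<open>If neither count reaches 4, the sum is at most \<open>3 + 3\<close>; otherwise the
  preceding lemma applies to \<open>M\<close> or to its transpose.\<close>

lemma antipodal_columns_rows_le:
  fixes M :: "int \<Rightarrow> int \<Rightarrow> bool"
  assumes per: "\<And>i j. M (i + 6) j = M i j" "\<And>i j. M i (j + 6) = M i j"
  shows "card {j \<in> {0..<6}. \<exists>t. antipodal_pair (\<lambda>i. M i j) (\<lambda>i. M i (j + 1)) t} +
    card {i \<in> {0..<6}. \<exists>u. antipodal_pair (M i) (M (i + 1)) u} \<le> 6"
  using antipodal_columns_block_rows[of M, OF per(2)]
    antipodal_columns_block_rows[of "\<lambda>i j. M j i", OF per(1)] by linarith

lemma sum_shift_6:
  fixes f :: "int \<Rightarrow> nat"
  assumes per: "\<And>x. f (x + 6) = f x"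
  shows "(\<Sum>x\<in>{0..<6}. f x) = f s + f (s + 1) + f (s + 2) + f (s + 3) + f (s + 4) + f (s + 5)"
proof -
  define S where "S = (\<lambda>s. f s + f (s + 1) + f (s + 2) + f (s + 3) + f (s + 4) + f (s + 5))"
  have "S (x + 1) = S x" for x using per[of x] by (simp add: S_def add.assoc)
  then have "(S (x + 1) = S 0) = (S x = S 0)" for x by simp
  from periodic_mod[of "\<lambda>x. S x = S 0", OF this, of s] have "S s = S 0" by simp
  then show ?thesis by (simp add: sum_upto_6 S_def)
qed

lemma extends_at_3_1:
  "extends_at 3 A B s 1 \<longleftrightarrow> A (s + 1) \<and> \<not> A s \<and> \<not> B s \<and> \<not> B (s + 1)"
  by (auto simp: extends_at_def eval_nat_numeral All_less_Suc)

lemma extends_at_3_2: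
  "extends_at 3 A B s 2 \<longleftrightarrow> A (s + 3) \<and> \<not> A s \<and> \<not> A (s + 1) \<and> \<not> A (s + 2) \<and>
     B s \<and> \<not> B (s + 1) \<and> \<not> B (s + 2) \<and> \<not> B (s + 3)"
  by (simp add: extends_at_def eval_nat_numeral All_less_Suc) (auto simp: add.commute)

lemma antipodal_pairI:
  assumes perA: "\<And>x. A (x + 6) = A x" and perB: "\<And>x. B (x + 6) = B x"
    and val: "\<And>k. 0 \<le> k \<Longrightarrow> k < 6 \<Longrightarrow> A (s + k) \<longleftrightarrow> k = 3" "\<And>k. 0 \<le> k \<Longrightarrow> k < 6 \<Longrightarrow> B (s + k) \<longleftrightarrow> k = 0"
  shows "antipodal_pair A B (s + 3)"
  unfolding antipodal_pair_def
proof
  fix i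
  have "A (s + (i - s) mod 6) = A i" "B (s + (i - s) mod 6) = B i"
    using periodic_mod[of "\<lambda>x. A (s + x)" 6 "i - s"] periodic_mod[of "\<lambda>x. B (s + x)" 6 "i - s"]
      perA[of "s + x" for x] perB[of "s + x" for x] by (simp_all add: add.assoc)
  moreover have "(i - s) mod 6 = 3 \<longleftrightarrow> 6 dvd i - (s + 3)" "(i - s) mod 6 = 0 \<longleftrightarrow> 6 dvd i - (s + 3) - 3"
    by presburger+
  ultimately show "(A i \<longleftrightarrow> 6 dvd i - (s + 3)) \<and> (B i \<longleftrightarrow> 6 dvd i - (s + 3) - 3)"
    using val[of "(i - s) mod 6"] by simp
qed

lemma antipodal_pair_commute: "antipodal_pair A B t \<Longrightarrow> antipodal_pair B A (t + 3)"
  unfolding antipodal_pair_def by (simp, presburger)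

lemma single_contact_commute: "single_contact A B = single_contact B A"
  by (auto simp: single_contact_def fun_eq_iff)

text \<open>The hypothesis fixes \<open>A\<close> and \<open>B\<close> at \<open>s\<close> to
  \<open>s + 3\<close> and leaves 16 patterns at \<open>s + 4\<close> and \<open>s + 5\<close>. With
  no further contact the pair is antipodal, with four single contacts and two closing starts:
  \<open>3 * 4 + 8 * 2 = 28\<close>. Any further contact destroys the second closing start and
  leaves at most four single contacts: \<open>3 * 4 + 8 = 20\<close>.\<close>

lemma contacts_le_if_closing:
  fixes A B :: "int \<Rightarrow> bool"
  assumes perA: "\<And>x. A (x + 6) = A x" and perB: "\<And>x. B (x + 6) = B x"
    and ext: "extends_at 3 A B s 2"
  shows "3 * (\<Sum>x\<in>{0..<6}. of_bool (single_contact A B x)) +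
      8 * (\<Sum>x\<in>{0..<6}. of_bool (extends_at 3 A B x 2 \<or> extends_at 3 B A x 2))
    \<le> 20 + 8 * (of_bool (\<exists>t. antipodal_pair A B t) :: nat)"
proof -
  have pers: "A (x + 7) = A (x + 1)" "A (x + 8) = A (x + 2)" "A (x + 9) = A (x + 3)"
    "B (x + 7) = B (x + 1)" "B (x + 8) = B (x + 2)" "B (x + 9) = B (x + 3)" for x
    using perA[of "x + 1"] perA[of "x + 2"] perA[of "x + 3"] perB[of "x + 1"] perB[of "x + 2"]
      perB[of "x + 3"] by (simp_all add: add.assoc)
  have eqs: "A (s + 6) = A s" "A (s + 7) = A (s + 1)" "A (s + 8) = A (s + 2)"
    "B (s + 6) = B s" "B (s + 7) = B (s + 1)" "B (s + 8) = B (s + 2)"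
    by (simp_all add: perA perB pers)
  have vals: "A (s + 3)" "\<not> A s" "\<not> A (s + 1)" "\<not> A (s + 2)"
    "B s" "\<not> B (s + 1)" "\<not> B (s + 2)" "\<not> B (s + 3)"
    using ext by (simp_all add: extends_at_3_2)
  have 1: "(\<Sum>x\<in>{0..<6}. of_bool (single_contact A B x)) =
      (\<Sum>k\<in>{0..<6}. of_bool (single_contact A B (s + k)) :: nat)"
    unfolding sum_upto_6[of "\<lambda>k. of_bool (single_contact A B (s + k))"] add_0_right
    by (rule sum_shift_6) (simp add: single_contact_def perA perB pers add.commute[of 7])
  have 2: "(\<Sum>x\<in>{0..<6}. of_bool (extends_at 3 A B x 2 \<or> extends_at 3 B A x 2)) =
      (\<Sum>k\<in>{0..<6}. of_bool (extends_at 3 A B (s + k) 2 \<or> extends_at 3 B A (s + k) 2) :: nat)"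
    unfolding sum_upto_6[of "\<lambda>k. of_bool (extends_at 3 A B (s + k) 2 \<or> extends_at 3 B A (s + k) 2)"] add_0_right
    by (rule sum_shift_6) (simp add: extends_at_3_2 perA perB pers add.commute[of 7] add.commute[of 8] add.commute[of 9])
  show ?thesis
  proof (cases "A (s + 4) \<or> A (s + 5) \<or> B (s + 4) \<or> B (s + 5)")
    case True
    then show ?thesis unfolding 1 2 sum_upto_6
      by (cases "A (s + 4)"; cases "A (s + 5)"; cases "B (s + 4)"; cases "B (s + 5)")
        (simp_all add: single_contact_def extends_at_3_2 eqs vals add.assoc)
  next
    case False
    have "k \<in> {0, 1, 2, 3, 4, 5}" if "0 \<le> k" "k < 6" for k :: int using that by auto
    then have "antipodal_pair A B (s + 3)"
      using vals False by (intro antipodal_pairI perA perB) fastforce+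
    then have "\<exists>t. antipodal_pair A B t" by blast
    moreover from False have "\<not> A (s + 4)" "\<not> A (s + 5)" "\<not> B (s + 4)" "\<not> B (s + 5)" by auto
    ultimately show ?thesis unfolding 1 2 sum_upto_6
      by (simp add: single_contact_def extends_at_3_2 eqs vals add.assoc)
  qed
qed

text \<open>Without a closing start, the six possible single contacts contribute at most 18.\<close>

lemma contacts_le:
  fixes A B :: "int \<Rightarrow> bool"
  assumes perA: "\<And>x. A (x + 6) = A x" and perB: "\<And>x. B (x + 6) = B x"
  shows "3 * (\<Sum>x\<in>{0..<6}. of_bool (single_contact A B x)) +
      8 * (\<Sum>x\<in>{0..<6}. of_bool (extends_at 3 A B x 2 \<or> extends_at 3 B A x 2))
    \<le> 20 + 8 * (of_bool (\<exists>t. antipodal_pair A B t) :: nat)"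
proof (cases "\<exists>s. extends_at 3 A B s 2 \<or> extends_at 3 B A s 2")
  case True
  then obtain s where "extends_at 3 A B s 2 \<or> extends_at 3 B A s 2" by blast
  then show ?thesis
  proof
    assume "extends_at 3 A B s 2"
    from contacts_le_if_closing[OF perA perB this] show ?thesis .
  next
    assume "extends_at 3 B A s 2"
    have "(\<exists>t. antipodal_pair B A t) \<longleftrightarrow> (\<exists>t. antipodal_pair A B t)"
      using antipodal_pair_commute by blast
    with contacts_le_if_closing[OF perB perA \<open>extends_at 3 B A s 2\<close>] show ?thesis
      by (simp only: single_contact_commute[of B A] disj_commute[of "extends_at 3 B A x 2" for x])
  qed
next
  case False
  have "(\<Sum>x\<in>{0..<6::int}. of_bool (single_contact A B x)) \<le> (\<Sum>x\<in>{0..<6::int}. 1 :: nat)"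
    by (rule sum_mono) simp
  with False show ?thesis by simp
qed

text \<open>Unlike single contacts, these are not symmetric in the two cycles, so they are counted
  below for \<open>M\<close> and for its transpose.\<close>

definition closing_contacts :: "(int \<Rightarrow> int \<Rightarrow> bool) \<Rightarrow> nat" where
  "closing_contacts M = (\<Sum>j\<in>{0..<6}. \<Sum>s\<in>{0..<6}. of_bool (extends_at 3 (\<lambda>i. M i j) (\<lambda>i. M i (j + 1)) s 2 \<or>
     extends_at 3 (\<lambda>i. M i (j + 1)) (\<lambda>i. M i j) s 2))"

text \<open>Add \<open>contacts_le\<close> over the six column pairs and the six row pairs: the
  bound is 240 plus 8 for each antipodal pair, of which there are at most 6. Half of 288 is
  144.\<close>

lemma contact_matrix_le:
  fixes M :: "int \<Rightarrow> int \<Rightarrow> bool"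
  assumes per: "\<And>i j. M (i + 6) j = M i j" "\<And>i j. M i (j + 6) = M i j"
  shows "3 * (\<Sum>j\<in>{0..<6}. \<Sum>s\<in>{0..<6}. of_bool (single_contact (\<lambda>i. M i j) (\<lambda>i. M i (j + 1)) s)) +
    4 * (closing_contacts M + closing_contacts (\<lambda>i j. M j i)) \<le> (144 :: nat)"
proof -
  let ?p = "\<lambda>j. \<exists>t. antipodal_pair (\<lambda>i. M i j) (\<lambda>i. M i (j + 1)) t"
  let ?q = "\<lambda>i. \<exists>u. antipodal_pair (M i) (M (i + 1)) u"
  let ?g = "\<Sum>j\<in>{0..<6}. \<Sum>s\<in>{0..<6}. of_bool (single_contact (\<lambda>i. M i j) (\<lambda>i. M i (j + 1)) s) :: nat"
  let ?g' = "\<Sum>i\<in>{0..<6}. \<Sum>s\<in>{0..<6}. of_bool (single_contact (M i) (M (i + 1)) s) :: nat"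
  have "3 * ?g + 8 * closing_contacts M = (\<Sum>j\<in>{0..<6}. 3 * (\<Sum>s\<in>{0..<6}. of_bool (single_contact (\<lambda>i. M i j) (\<lambda>i. M i (j + 1)) s)) +
      8 * (\<Sum>s\<in>{0..<6}. of_bool (extends_at 3 (\<lambda>i. M i j) (\<lambda>i. M i (j + 1)) s 2 \<or> extends_at 3 (\<lambda>i. M i (j + 1)) (\<lambda>i. M i j) s 2)))"
    by (simp only: closing_contacts_def sum_distrib_left sum.distrib)
  also have "\<dots> \<le> (\<Sum>j\<in>{0..<6::int}. 20 + 8 * of_bool (?p j))"
    by (intro sum_mono contacts_le per)
  also have "\<dots> = 120 + 8 * card {j \<in> {0..<6}. ?p j}"
    by (simp add: sum.distrib sum_distrib_left[symmetric] Int_def)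
  finally have 1: "3 * ?g + 8 * closing_contacts M \<le> 120 + 8 * card {j \<in> {0..<6}. ?p j}" .
  have "3 * ?g' + 8 * closing_contacts (\<lambda>i j. M j i) = (\<Sum>i\<in>{0..<6}. 3 * (\<Sum>s\<in>{0..<6}. of_bool (single_contact (M i) (M (i + 1)) s)) +
      8 * (\<Sum>s\<in>{0..<6}. of_bool (extends_at 3 (M i) (M (i + 1)) s 2 \<or> extends_at 3 (M (i + 1)) (M i) s 2)))"
    by (simp only: closing_contacts_def sum_distrib_left sum.distrib)
  also have "\<dots> \<le> (\<Sum>i\<in>{0..<6::int}. 20 + 8 * of_bool (?q i))"
    by (intro sum_mono contacts_le per)
  also have "\<dots> = 120 + 8 * card {i \<in> {0..<6}. ?q i}"
    by (simp add: sum.distrib sum_distrib_left[symmetric] Int_def)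
  finally have 2: "3 * ?g' + 8 * closing_contacts (\<lambda>i j. M j i) \<le> 120 + 8 * card {i \<in> {0..<6}. ?q i}" .
  \<comment> \<open>A single contact is a property of the four entries of a 2 by 2 block of
    \<open>M\<close>.\<close>
  have "?g' = ?g"
    unfolding single_contact_def by (subst sum.swap) (simp add: add_ac)
  have "3 * g + 4 * (c + c') \<le> 144"
    if "3 * g + 8 * c \<le> 120 + 8 * a" "3 * g' + 8 * c' \<le> 120 + 8 * b" "a + b \<le> 6" "g' = g"
    for g g' c c' a b :: nat
  proof -
    have "2 * (3 * g + 4 * (c + c')) \<le> 240 + 8 * (a + b)" using that(1,2,4) by simp
    also have "\<dots> \<le> 240 + 8 * 6" using that(3) by (intro add_left_mono mult_left_mono) simp_all
    finally show ?thesis by simp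
  qed
  from this[OF 1 2 antipodal_columns_rows_le[of M, OF per] \<open>?g' = ?g\<close>] show ?thesis .
qed

section \<open>Averages over pairs of cycles and their symmetries\<close>

definition contact :: "'a graph \<Rightarrow> (int \<Rightarrow> 'a) \<Rightarrow> (int \<Rightarrow> 'a) \<Rightarrow> int \<Rightarrow> int \<Rightarrow> bool" where
  "contact G w w' i j \<longleftrightarrow> {w' j, w i} \<in> edges G"

text \<open>An unnormalized expectation over two independent cycles. Rotating, reflecting or
  exchanging the cycles acts on the indices of the contact matrix and keeps the sum, while \<phi>
  can be bounded one matrix at a time.\<close>

definition contact_sum :: "'a graph \<Rightarrow> nat \<Rightarrow> ((int \<Rightarrow> int \<Rightarrow> bool) \<Rightarrow> real) \<Rightarrow> real" where
  "contact_sum G k \<phi> = (\<Sum>w\<in>cycle_maps G k. \<Sum>w'\<in>cycle_maps G k. \<phi> (contact G w w'))"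

lemma contact_sum_shift:
  "contact_sum G k (\<lambda>M. \<phi> (\<lambda>i j. M (s + i) (t + j))) = contact_sum G k \<phi>"
proof -
  have "contact_sum G k (\<lambda>M. \<phi> (\<lambda>i j. M (s + i) (t + j))) =
      (\<Sum>w\<in>cycle_maps G k. \<Sum>w'\<in>cycle_maps G k. \<phi> (contact G (\<lambda>i. w (s + i)) (\<lambda>j. w' (t + j))))"
    by (simp add: contact_sum_def contact_def[abs_def])
  also have "\<dots> = (\<Sum>w\<in>cycle_maps G k. \<Sum>w'\<in>cycle_maps G k. \<phi> (contact G (\<lambda>i. w (s + i)) w'))"
    by (intro sum.cong refl sum_cycle_maps_shift)
  also have "\<dots> = contact_sum G k \<phi>"
    unfolding contact_sum_def
    by (rule sum_cycle_maps_shift[where \<phi> = "\<lambda>w. \<Sum>w'\<in>cycle_maps G k. \<phi> (contact G w w')"])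
  finally show ?thesis .
qed

lemma contact_sum_reflect_row:
  "contact_sum G k (\<lambda>M. \<phi> (\<lambda>i. M (s - i))) = contact_sum G k \<phi>"
proof -
  have "contact_sum G k (\<lambda>M. \<phi> (\<lambda>i. M (s - i))) =
      (\<Sum>w\<in>cycle_maps G k. \<Sum>w'\<in>cycle_maps G k. \<phi> (contact G (\<lambda>i. w (s - i)) w'))"
    by (simp add: contact_sum_def contact_def[abs_def])
  also have "\<dots> = contact_sum G k \<phi>"
    unfolding contact_sum_def
    by (rule sum_cycle_maps_reflect[where \<phi> = "\<lambda>w. \<Sum>w'\<in>cycle_maps G k. \<phi> (contact G w w')"])
  finally show ?thesis .
qed

lemma contact_sum_transpose:
  "contact_sum G k (\<lambda>M. \<phi> (\<lambda>i j. M j i)) = contact_sum G k \<phi>"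
proof -
  have "(\<lambda>i j. contact G w w' j i) = contact G w' w" for w w'
    by (simp add: fun_eq_iff contact_def insert_commute)
  then show ?thesis unfolding contact_sum_def by (subst sum.swap) simp
qed

lemma contact_sum_reflect_column:
  "contact_sum G k (\<lambda>M. \<phi> (\<lambda>i j. M i (s - j))) = contact_sum G k \<phi>"
  using contact_sum_transpose[of G k "\<lambda>M. \<phi> (\<lambda>i j. M (s - j) i)"]
    contact_sum_reflect_row[of G k "\<lambda>M. \<phi> (\<lambda>i j. M j i)" s]
    contact_sum_transpose[of G k \<phi>]
  by simp

lemma contact_sum_add: "contact_sum G k (\<lambda>M. \<phi> M + \<psi> M) = contact_sum G k \<phi> + contact_sum G k \<psi>"
  by (simp add: contact_sum_def sum.distrib)

lemma contact_sum_sum: "contact_sum G k (\<lambda>M. \<Sum>x\<in>X. \<phi> x M) = (\<Sum>x\<in>X. contact_sum G k (\<phi> x))"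
proof -
  have "contact_sum G k (\<lambda>M. \<Sum>x\<in>X. \<phi> x M) =
      (\<Sum>w\<in>cycle_maps G k. \<Sum>x\<in>X. \<Sum>w'\<in>cycle_maps G k. \<phi> x (contact G w w'))"
    unfolding contact_sum_def by (intro sum.cong refl sum.swap)
  also have "\<dots> = (\<Sum>x\<in>X. contact_sum G k (\<phi> x))"
    unfolding contact_sum_def by (rule sum.swap)
  finally show ?thesis .
qed

lemma contact_sum_mult: "contact_sum G k (\<lambda>M. c * \<phi> M) = c * contact_sum G k \<phi>"
  by (simp add: contact_sum_def sum_distrib_left)

lemma contact_periodic:
  assumes "w \<in> cycle_maps G k" "w' \<in> cycle_maps G k"
  shows "contact G w w' (i + int k) j = contact G w w' i j" "contact G w w' i (j + int k) = contact G w w' i j"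
proof -
  have "w (i + int k) = w i" "w' (j + int k) = w' j"
    by (simp_all add: cycle_maps_eq_iff[OF assms(1)] cycle_maps_eq_iff[OF assms(2)])
  then show "contact G w w' (i + int k) j = contact G w w' i j" "contact G w w' i (j + int k) = contact G w w' i j"
    by (simp_all add: contact_def)
qed

lemma contact_sum_le:
  assumes "\<And>M. (\<And>i j. M (i + int k) j = M i j) \<Longrightarrow> (\<And>i j. M i (j + int k) = M i j) \<Longrightarrow> \<phi> M \<le> c"
  shows "contact_sum G k \<phi> \<le> c * real (card (cycle_maps G k)) ^ 2"
proof -
  have "contact_sum G k \<phi> \<le> (\<Sum>w\<in>cycle_maps G k. \<Sum>w'\<in>cycle_maps G k. c)"
    unfolding contact_sum_def by (intro sum_mono assms contact_periodic)
  then show ?thesis by (simp add: power2_eq_square mult_ac)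
qed

lemma extension_prob_eq_contact_sum:
  assumes "i > 0"
  shows "extension_prob G l i * real (card (cycle_maps G (2 * l))) ^ 2 =
    contact_sum G (2 * l) (\<lambda>M. of_bool (extends_at l (\<lambda>a. M a 0) (\<lambda>a. M a 1) 0 i))"
proof (cases "card (cycle_maps G (2 * l)) = 0")
  case True
  then show ?thesis by (auto simp: contact_sum_def card_eq_0_iff)
next
  case False
  have "(w' 0, w' 1) \<in> extending_arcs G l i (\<lambda>j. w (int j)) \<longleftrightarrow>
      extends_at l (\<lambda>a. contact G w w' a 0) (\<lambda>a. contact G w w' a 1) 0 i"
    if "w' \<in> cycle_maps G (2 * l)" for w w'
  proof -
    have "{w' 0, w' 1} \<in> edges G" by (simp add: cycle_maps_edge_iff[OF that])
    with extending_arcs_iff_extends_at[OF assms, of "w' 0" "w' 1" G l w 0] show ?thesis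
      by (simp add: contact_def[abs_def])
  qed
  with False show ?thesis
    unfolding extension_prob_def contact_sum_def by simp
qed

text \<open>The \<open>2 * l\<close> rotations of \<open>w\<close> and the two orientations of the
  first arc of \<open>w'\<close> give \<open>4 * l\<close> terms with equal averages. For a fixed
  pair of cycles they add up to at most \<open>l\<close>.\<close>

lemma sum_extension_prob_le:
  assumes l: "l \<ge> 4" and ne: "cycle_maps G (2 * l) \<noteq> {}" "finite (cycle_maps G (2 * l))"
  shows "(\<Sum>i=1..<l. extension_prob G l i) \<le> 1 / 4"
proof -
  define c where "c = real (card (cycle_maps G (2 * l))) ^ 2"
  define \<phi> where "\<phi> = (\<lambda>i (M :: int \<Rightarrow> int \<Rightarrow> bool). of_bool (extends_at l (\<lambda>a. M a 0) (\<lambda>a. M a 1) 0 i) :: real)"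
  have c: "c > 0" using ne by (simp add: c_def card_gt_0_iff)
  \<comment> \<open>\<open>1 - b\<close> exchanges the ends of the arc; \<open>0 + b\<close> keeps
    the shape of \<open>contact_sum_shift\<close>.\<close>
  have "contact_sum G (2 * l) (\<lambda>M. \<Sum>s\<in>{0..<2 * int l}. \<Sum>i=1..<l.
      \<phi> i (\<lambda>a b. M (s + a) (0 + b)) + \<phi> i (\<lambda>a b. M (s + a) (1 - b))) \<le> real l * c"
    unfolding c_def
  proof (rule contact_sum_le)
    fix M :: "int \<Rightarrow> int \<Rightarrow> bool"
    assume per: "\<And>i j. M (i + int (2 * l)) j = M i j"
    have "(\<Sum>s\<in>{0..<2 * int l}. \<Sum>i=1..<l. \<phi> i (\<lambda>a b. M (s + a) (0 + b)) + \<phi> i (\<lambda>a b. M (s + a) (1 - b))) =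
      real (\<Sum>s\<in>{0..<2 * int l}. \<Sum>i=1..<l. of_bool (extends_at l (\<lambda>a. M a 0) (\<lambda>a. M a 1) s i) +
        of_bool (extends_at l (\<lambda>a. M a 1) (\<lambda>a. M a 0) s i))"
      by (simp add: \<phi>_def extends_at_def)
    also have "\<dots> \<le> real l"
      using sum_extends_at_le[OF l, of "\<lambda>a. M a 0" "\<lambda>a. M a 1"] per by (simp del: of_nat_sum)
    finally show "(\<Sum>s\<in>{0..<2 * int l}. \<Sum>i=1..<l. \<phi> i (\<lambda>a b. M (s + a) (0 + b)) + \<phi> i (\<lambda>a b. M (s + a) (1 - b))) \<le> real l" .
  qed
  also have "contact_sum G (2 * l) (\<lambda>M. \<Sum>s\<in>{0..<2 * int l}. \<Sum>i=1..<l.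
      \<phi> i (\<lambda>a b. M (s + a) (0 + b)) + \<phi> i (\<lambda>a b. M (s + a) (1 - b))) =
      (\<Sum>s\<in>{0..<2 * int l}. \<Sum>i=1..<l. 2 * contact_sum G (2 * l) (\<phi> i))"
  proof -
    have "contact_sum G (2 * l) (\<lambda>M. \<phi> i (\<lambda>a b. M (s + a) (1 - b))) = contact_sum G (2 * l) (\<phi> i)" for i s
      using contact_sum_shift[of G "2 * l" "\<lambda>M. \<phi> i (\<lambda>a b. M a (1 - b))" s 0]
        contact_sum_reflect_column[of G "2 * l" "\<phi> i" 1] by simp
    then show ?thesis
      unfolding contact_sum_sum contact_sum_add contact_sum_shift by simp
  qed
  also have "\<dots> = (\<Sum>s\<in>{0..<2 * int l}. \<Sum>i=1..<l. 2 * (extension_prob G l i * c))"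
    by (intro sum.cong refl) (simp add: extension_prob_eq_contact_sum \<phi>_def c_def)
  also have "\<dots> = 4 * real l * (\<Sum>i=1..<l. extension_prob G l i) * c"
    by (simp add: sum_distrib_left sum_distrib_right mult_ac)
  finally show ?thesis using c l by (simp add: field_simps)
qed

lemma extension_prob_3_le:
  assumes ne: "cycle_maps G 6 \<noteq> {}" "finite (cycle_maps G 6)"
  shows "3 * extension_prob G 3 1 + 4 * extension_prob G 3 2 \<le> 1"
proof -
  define c where "c = real (card (cycle_maps G 6)) ^ 2"
  have c: "c > 0" using ne by (simp add: c_def card_gt_0_iff)
  define \<phi> where "\<phi> = (\<lambda>i (M :: int \<Rightarrow> int \<Rightarrow> bool). of_bool (extends_at 3 (\<lambda>a. M a 0) (\<lambda>a. M a 1) 0 i) :: real)"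
  define \<sigma> where "\<sigma> = (\<lambda>M :: int \<Rightarrow> int \<Rightarrow> bool. \<Sum>j\<in>{0..<6}. \<Sum>s\<in>{0..<6}.
    of_bool (single_contact (\<lambda>i. M i j) (\<lambda>i. M i (j + 1)) s) :: real)"
  have refl: "contact_sum G 6 (\<lambda>M. \<psi> (\<lambda>a b. M (s + a) (j + (1 - b)))) = contact_sum G 6 \<psi>"
    "contact_sum G 6 (\<lambda>M. \<psi> (\<lambda>a b. M (s + (1 - a)) (j + b))) = contact_sum G 6 \<psi>"
    "contact_sum G 6 (\<lambda>M. \<psi> (\<lambda>a b. M (s + (1 - a)) (j + (1 - b)))) = contact_sum G 6 \<psi>" for \<psi> s j
    using contact_sum_shift[of G 6 "\<lambda>M. \<psi> (\<lambda>a b. M a (1 - b))" s j]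
      contact_sum_shift[of G 6 "\<lambda>M. \<psi> (\<lambda>a b. M (1 - a) b)" s j]
      contact_sum_shift[of G 6 "\<lambda>M. \<psi> (\<lambda>a b. M (1 - a) (1 - b))" s j]
      contact_sum_reflect_column[of G 6 \<psi> 1] contact_sum_reflect_row[of G 6 \<psi> 1]
      contact_sum_reflect_row[of G 6 "\<lambda>M. \<psi> (\<lambda>a b. M a (1 - b))" 1] by simp_all
  \<comment> \<open>Each of the four places of a single contact is step 1 for one choice of
    directions of the two cycles, which gives \<open>36 * 4\<close>.\<close>
  have \<sigma>: "contact_sum G 6 \<sigma> = 144 * contact_sum G 6 (\<phi> 1)"
  proof -
    have "\<sigma> = (\<lambda>M. \<Sum>j\<in>{0..<6}. \<Sum>s\<in>{0..<6}. \<phi> 1 (\<lambda>a b. M (s + a) (j + b)) + \<phi> 1 (\<lambda>a b. M (s + a) (j + (1 - b))) +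
        \<phi> 1 (\<lambda>a b. M (s + (1 - a)) (j + b)) + \<phi> 1 (\<lambda>a b. M (s + (1 - a)) (j + (1 - b))))"
      unfolding \<sigma>_def \<phi>_def extends_at_3_1
      by (intro ext sum.cong refl) (auto simp: single_contact_def)
    then show ?thesis
      by (simp only: contact_sum_sum contact_sum_add contact_sum_shift refl) simp
  qed
  \<comment> \<open>Only the direction of the arc varies here, and its two orientations exclude each
    other, which gives \<open>36 * 2\<close>.\<close>
  have \<beta>: "contact_sum G 6 (\<lambda>M. real (closing_contacts M)) = 72 * contact_sum G 6 (\<phi> 2)"
  proof -
    have "(\<lambda>M. real (closing_contacts M)) =
        (\<lambda>M. \<Sum>j\<in>{0..<6}. \<Sum>s\<in>{0..<6}. \<phi> 2 (\<lambda>a b. M (s + a) (j + b)) + \<phi> 2 (\<lambda>a b. M (s + a) (j + (1 - b))))"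
      unfolding closing_contacts_def \<phi>_def extends_at_3_2 of_nat_sum
      by (intro ext sum.cong refl) auto
    then show ?thesis
      by (simp only: contact_sum_sum contact_sum_add contact_sum_shift refl) simp
  qed
  have "contact_sum G 6 (\<lambda>M. 3 * \<sigma> M + 4 * (real (closing_contacts M) + real (closing_contacts (\<lambda>i j. M j i)))) \<le> 144 * c"
    unfolding c_def
  proof (rule contact_sum_le)
    fix M :: "int \<Rightarrow> int \<Rightarrow> bool"
    assume "\<And>i j. M (i + int 6) j = M i j" "\<And>i j. M i (j + int 6) = M i j"
    then have "real (3 * (\<Sum>j\<in>{0..<6}. \<Sum>s\<in>{0..<6}. of_bool (single_contact (\<lambda>i. M i j) (\<lambda>i. M i (j + 1)) s)) +
        4 * (closing_contacts M + closing_contacts (\<lambda>i j. M j i))) \<le> real 144"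
      by (intro of_nat_mono contact_matrix_le) simp_all
    then show "3 * \<sigma> M + 4 * (real (closing_contacts M) + real (closing_contacts (\<lambda>i j. M j i))) \<le> 144"
      by (simp add: \<sigma>_def)
  qed
  also have "contact_sum G 6 (\<lambda>M. 3 * \<sigma> M + 4 * (real (closing_contacts M) + real (closing_contacts (\<lambda>i j. M j i)))) =
      144 * (3 * contact_sum G 6 (\<phi> 1) + 4 * contact_sum G 6 (\<phi> 2))"
    by (simp only: contact_sum_add contact_sum_mult \<sigma> \<beta>
        contact_sum_transpose[where \<phi> = "\<lambda>M. real (closing_contacts M)"]) simp
  finally have "3 * contact_sum G 6 (\<phi> 1) + 4 * contact_sum G 6 (\<phi> 2) \<le> c" by simp
  then have "(3 * extension_prob G 3 1 + 4 * extension_prob G 3 2) * c \<le> 1 * c"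
    using extension_prob_eq_contact_sum[of 1 G 3] extension_prob_eq_contact_sum[of 2 G 3]
    by (simp add: \<phi>_def c_def algebra_simps)
  then show ?thesis using c by (simp only: mult_le_cancel_right_pos)
qed

section \<open>Upper bounds\<close>

text \<open>Arithmetic and geometric means, by Jensen; a factor 0 is set apart because of the
  logarithm.\<close>

lemma prod_le_mean_power:
  fixes f :: "'a \<Rightarrow> real"
  assumes fin: "finite X" and nonneg: "\<And>x. x \<in> X \<Longrightarrow> f x \<ge> 0"
  shows "(\<Prod>x\<in>X. f x) \<le> ((\<Sum>x\<in>X. f x) / real (card X)) ^ card X"
proof (cases "X = {} \<or> (\<exists>x\<in>X. f x = 0)")
  case True
  then show ?thesis
  proof
    assume "\<exists>x\<in>X. f x = 0"
    then have "(\<Prod>x\<in>X. f x) = 0" using fin by simp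
    then show ?thesis using nonneg by (simp add: sum_nonneg)
  qed simp
next
  case False
  then have pos: "f x > 0" if "x \<in> X" for x using nonneg[OF that] that by force
  have mean: "(\<Sum>x\<in>X. f x) / real (card X) > 0"
    using False fin pos by (intro divide_pos_pos sum_pos) (auto simp: card_gt_0_iff)
  have "ln (\<Prod>x\<in>X. f x) = (\<Sum>x\<in>X. ln (f x))"
    by (rule ln_prod[OF fin]) (use pos less_irrefl in metis)
  also have "\<dots> \<le> real (card X) * ln ((\<Sum>x\<in>X. f x) / real (card X))"
    using False fin pos by (intro sum_ln_le_card_mult_ln_mean) auto
  also have "\<dots> = ln (((\<Sum>x\<in>X. f x) / real (card X)) ^ card X)"
    by (rule ln_realpow[symmetric])
  finally show ?thesis
    using ln_le_cancel_iff[of "\<Prod>x\<in>X. f x" "((\<Sum>x\<in>X. f x) / real (card X)) ^ card X"] mean pos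
    by (simp add: prod_pos)
qed

text \<open>The first arc and the opposite edge, taken without direction, determine the map:
  \<open>w 2\<close> is the end of that edge not adjacent to \<open>w 0\<close>. This leaves at most
  \<open>2 * m * m\<close> maps, with eight for each copy.\<close>

lemma induced_count_cycle_4_le:
  assumes G: "simple_graph G"
  shows "real (induced_count G (cycle_graph 4)) \<le> real (card (edges G)) ^ 2 / 4"
proof -
  let ?W = "cycle_maps G 4"
  let ?A = "{(x, y). {x, y} \<in> edges G}"
  let ?F = "\<lambda>w. ((w 0, w 1), {w 2, w 3})"
  have "inj_on ?F ?W"
  proof (rule inj_onI)
    fix w w' assume w: "w \<in> ?W" and w': "w' \<in> ?W" and eq: "?F w = ?F w'"
    from eq have "w 2 = w' 2 \<and> w 3 = w' 3 \<or> w 2 = w' 3 \<and> w 3 = w' 2"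
      by (auto simp: doubleton_eq_iff)
    moreover have "w 2 \<noteq> w' 3"
    proof
      assume "w 2 = w' 3"
      moreover have "{w' 3, w' 0} \<in> edges G" by (simp add: cycle_maps_edge_iff[OF w'])
      ultimately have "{w 2, w 0} \<in> edges G" using eq by simp
      then show False by (simp add: cycle_maps_edge_iff[OF w])
    qed
    ultimately have 23: "w 2 = w' 2" "w 3 = w' 3" by auto
    show "w = w'"
    proof (rule cycle_maps_eqI[OF w w'])
      fix i :: int assume "0 \<le> i" "i < int 4"
      then have "i \<in> {0, 1, 2, 3}" by auto
      with 23 eq show "w i = w' i" by auto
    qed simp
  qed
  moreover have "?F ` ?W \<subseteq> ?A \<times> edges G"
  proof (rule image_subsetI)
    fix w assume w: "w \<in> ?W"
    show "?F w \<in> ?A \<times> edges G" by (simp add: cycle_maps_edge_iff[OF w])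
  qed
  ultimately have "card ?W \<le> card (?A \<times> edges G)"
    using finite_arcs[OF G] finite_edges[OF G] by (intro card_inj_on_le) auto
  also have "\<dots> \<le> 2 * card (edges G) * card (edges G)"
    unfolding card_cartesian_product using card_arcs_le[OF G] by (rule mult_le_mono1)
  finally have "8 * induced_count G (cycle_graph 4) \<le> 2 * card (edges G) * card (edges G)"
    using induced_count_le_cycle_maps[of G 4] G by (simp add: simple_graph_def)
  then have "real (8 * induced_count G (cycle_graph 4)) \<le> real (2 * card (edges G) * card (edges G))"
    by (simp only: of_nat_le_iff)
  then show ?thesis by (simp add: power2_eq_square)
qed

lemma induced_count_cycle_6_le:
  assumes G: "simple_graph G"
  shows "real (induced_count G (cycle_graph 6)) \<le> 3 * (real (card (edges G)) / 6) ^ 3"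
proof (cases "cycle_maps G 6 = {}")
  case True
  then show ?thesis using induced_count_le_cycle_maps[of G 6] G by (simp add: simple_graph_def)
next
  case False
  define m where "m = real (card (edges G))"
  define P where "P = extension_prob G 3"
  have fin: "finite (cycle_maps G 6)" by (rule finite_cycle_maps) (use G in \<open>simp_all add: simple_graph_def\<close>)
  have P_nonneg: "P i \<ge> 0" for i by (simp add: P_def extension_prob_def sum_nonneg)
  \<comment> \<open>The inequality of means for \<open>3 * P 1\<close> and \<open>4 * P 2\<close>,
    whose sum is at most 1.\<close>
  have "0 \<le> (3 * P 1 - 4 * P 2) ^ 2" by simp
  then have "48 * (P 1 * P 2) \<le> (3 * P 1 + 4 * P 2) ^ 2" by (simp add: power2_eq_square algebra_simps)
  also have "\<dots> \<le> 1 ^ 2"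
    using extension_prob_3_le[OF False fin] P_nonneg by (intro power_mono) (auto simp: P_def)
  finally have P12: "P 1 * P 2 \<le> 1 / 48" by simp
  have "{1..<3} = {1, 2 :: nat}" by auto
  then have "real (card (cycle_maps G 6)) \<le> (2 * m) ^ 3 * (P 1 * P 2)"
    using card_cycle_maps_le_prod[OF G, of 3] by (simp add: m_def P_def)
  also have "\<dots> \<le> (2 * m) ^ 3 * (1 / 48)"
    using P12 by (rule mult_left_mono) (simp add: m_def)
  finally have "real (card (cycle_maps G 6)) \<le> m ^ 3 / 6" by (simp add: power_mult_distrib)
  moreover have "real (12 * induced_count G (cycle_graph 6)) \<le> real (card (cycle_maps G 6))"
    using induced_count_le_cycle_maps[of G 6] G by (simp only: of_nat_le_iff) (simp add: simple_graph_def)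
  ultimately show ?thesis unfolding m_def by (simp add: power_divide)
qed

lemma induced_count_cycle_even_le:
  assumes G: "simple_graph G" and l: "l \<ge> 4"
  shows "real (induced_count G (cycle_graph (2 * l))) \<le>
    (real (card (edges G)) / (2 * real l)) ^ l * (1 + 1 / (real l - 1)) ^ (l - 1)"
proof (cases "cycle_maps G (2 * l) = {}")
  case True
  then have "induced_count G (cycle_graph (2 * l)) = 0"
    using induced_count_le_cycle_maps[of G "2 * l"] G l by (simp add: simple_graph_def)
  then show ?thesis using l by simp
next
  case False
  define m where "m = real (card (edges G))"
  define P where "P = extension_prob G l"
  have fin: "finite (cycle_maps G (2 * l))"
    by (rule finite_cycle_maps) (use G l in \<open>simp_all add: simple_graph_def\<close>)
  have P_nonneg: "P i \<ge> 0" for i by (simp add: P_def extension_prob_def sum_nonneg)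
  have l1: "real (l - 1) = real l - 1" "real l - 1 > 0" using l by (simp_all add: of_nat_diff)
  have "(\<Prod>i=1..<l. P i) \<le> ((\<Sum>i=1..<l. P i) / real (card {1..<l})) ^ card {1..<l}"
    by (rule prod_le_mean_power) (auto simp: P_nonneg)
  also have "\<dots> \<le> (1 / (4 * (real l - 1))) ^ (l - 1)"
  proof -
    have "(\<Sum>i=1..<l. P i) / (real l - 1) \<le> (1 / 4) / (real l - 1)"
      using sum_extension_prob_le[OF l False fin] l1 by (intro divide_right_mono) (auto simp: P_def)
    then have "((\<Sum>i=1..<l. P i) / (real l - 1)) ^ (l - 1) \<le> (1 / 4 / (real l - 1)) ^ (l - 1)"
      using P_nonneg l1 by (intro power_mono divide_nonneg_pos sum_nonneg) auto
    then show ?thesis by (simp only: card_atLeastLessThan l1(1) divide_divide_eq_left)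
  qed
  finally have P: "(\<Prod>i=1..<l. P i) \<le> (1 / (4 * (real l - 1))) ^ (l - 1)" .
  have "real (4 * l * induced_count G (cycle_graph (2 * l))) \<le> real (card (cycle_maps G (2 * l)))"
    using induced_count_le_cycle_maps[of G "2 * l"] G l
    by (simp only: of_nat_le_iff) (simp add: simple_graph_def)
  also have "\<dots> \<le> (2 * m) ^ l * (\<Prod>i=1..<l. P i)"
    using card_cycle_maps_le_prod[OF G, of l] l by (simp add: m_def P_def)
  also have "\<dots> \<le> (2 * m) ^ l * (1 / (4 * (real l - 1))) ^ (l - 1)"
    using P by (rule mult_left_mono) (simp add: m_def)
  \<comment> \<open>With \<open>n = l - 1\<close>, each of the \<open>n\<close> products of
    \<open>m / (2 * l)\<close> and \<open>1 + 1 / n\<close> equals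
    \<open>m / (2 * n)\<close>.\<close>
  also have "\<dots> = 4 * real l * ((m / (2 * real l)) ^ l * (1 + 1 / (real l - 1)) ^ (l - 1))"
  proof -
    obtain n where n: "l = Suc n" using l by (cases l) auto
    then have n0: "real n > 0" using l by simp
    then have "1 + 1 / real n = real (Suc n) / real n" by (simp add: field_simps)
    then have "m / (2 * real (Suc n)) * (1 + 1 / real n) = m / (2 * real n)"
      by (simp del: of_nat_Suc)
    moreover have "2 * m * (1 / (4 * real n)) = m / (2 * real n)" by simp
    ultimately have "(2 * m) ^ Suc n * (1 / (4 * real n)) ^ n = 2 * m * (m / (2 * real n)) ^ n"
      "(m / (2 * real (Suc n))) ^ Suc n * (1 + 1 / real n) ^ n = m / (2 * real (Suc n)) * (m / (2 * real n)) ^ n"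
      by (simp_all only: power_Suc mult.assoc power_mult_distrib[symmetric])
    moreover have "2 * m * x = 4 * real (Suc n) * (m / (2 * real (Suc n)) * x)" for x
      by (simp del: of_nat_Suc)
    moreover have "real (Suc n) - 1 = real n" "Suc n - 1 = n" by simp_all
    ultimately show ?thesis unfolding n by (simp only:)
  qed
  finally show ?thesis using l by (simp add: m_def)
qed

section \<open>From single graphs to \<open>rho\<close>\<close>

text \<open>\<open>Max\<close> is meaningful only on a finite nonempty set: the bound gives
  finiteness, and a star with \<open>m\<close> edges gives a member.\<close>

lemma rho_le:
  fixes H :: "'b graph"
  assumes "\<And>G :: nat graph. simple_graph G \<Longrightarrow> card (edges G) = m \<Longrightarrow> real (induced_count G H) \<le> b"
  shows "real (rho H m) \<le> b"
proof -
  let ?C = "{induced_count G H | G :: nat graph. simple_graph G \<and> card (edges G) = m}"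
  have "?C \<subseteq> {..nat \<lfloor>b\<rfloor>}" using assms by (auto simp: le_nat_floor)
  then have fin: "finite ?C" by (rule finite_subset) simp
  define G :: "nat graph" where "G = ({..m}, (\<lambda>i. {0, Suc i}) ` {..<m})"
  have "inj_on (\<lambda>i. {0, Suc i}) {..<m}" by (auto simp: inj_on_def doubleton_eq_iff)
  then have "simple_graph G" "card (edges G) = m"
    by (auto simp: G_def simple_graph_def card_image)
  then have "?C \<noteq> {}" by blast
  from Max_in[OF fin this] obtain G' :: "nat graph"
    where "rho H m = induced_count G' H" "simple_graph G'" "card (edges G') = m"
    unfolding rho_def by auto
  with assms show ?thesis by metis
qed

text \<open>Relabel the vertices of \<open>G\<close> as \<open>0, ..., n - 1\<close> and supply the
  missing edges by a star on new vertices. No edge at an old vertex is added, so all induced copies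
  survive. The bound makes the maximum one over a finite set.\<close>

lemma induced_count_le_rho:
  fixes G :: "'a graph" and H :: "'b graph"
  assumes G: "simple_graph G" and m: "card (edges G) \<le> m"
    and bound: "\<And>G :: nat graph. simple_graph G \<Longrightarrow> card (edges G) = m \<Longrightarrow> real (induced_count G H) \<le> b"
  shows "induced_count G H \<le> rho H m"
proof -
  have finV: "finite (verts G)" using G by (simp add: simple_graph_def)
  obtain f n where f: "bij_betw f (verts G) {0..<n :: nat}"
    using ex_bij_betw_finite_nat[OF finV] by blast
  have injf: "inj_on f (verts G)" and fV: "f ` verts G = {0..<n}" using f by (auto simp: bij_betw_def)
  define r where "r = m - card (edges G)"
  define E1 where "E1 = (\<lambda>e. f ` e) ` edges G"
  define E2 where "E2 = (\<lambda>i. {n, Suc (n + i)}) ` {..<r}"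
  define G' :: "nat graph" where "G' = ({..n + r}, E1 \<union> E2)"
  have eV: "e \<subseteq> verts G" "card e = 2" if "e \<in> edges G" for e
    using G that by (auto simp: simple_graph_def)
  have E1: "e \<subseteq> {0..<n}" "card e = 2" if "e \<in> E1" for e
  proof -
    from that obtain e' where e': "e' \<in> edges G" "e = f ` e'" by (auto simp: E1_def)
    show "e \<subseteq> {0..<n}" unfolding e'(2) fV[symmetric] using eV(1)[OF e'(1)] by (rule image_mono)
    show "card e = 2" using e' eV[OF e'(1)] inj_on_subset[OF injf] by (simp add: card_image)
  qed
  have disj: "E1 \<inter> E2 = {}" using E1(1) by (force simp: E2_def)
  have simple: "simple_graph G'"
    unfolding simple_graph_def
  proof (intro conjI ballI)
    fix e assume e: "e \<in> edges G'"
    have "{0..<n} \<subseteq> {..n + r}" by auto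
    then show "e \<subseteq> verts G'" using e E1(1)[of e] by (auto simp: G'_def E2_def)
    show "card e = 2" using e E1(2)[of e] by (auto simp: G'_def E2_def)
  qed (simp add: G'_def)
  have injE: "inj_on (\<lambda>e. f ` e) (edges G)"
  proof (rule inj_onI)
    fix e e' assume "e \<in> edges G" "e' \<in> edges G" "f ` e = f ` e'"
    then show "e = e'" using inj_on_image_eq_iff[OF injf] eV by blast
  qed
  have "inj_on (\<lambda>i. {n, Suc (n + i)}) {..<r}" by (auto simp: inj_on_def doubleton_eq_iff)
  then have "card (E1 \<union> E2) = card (edges G) + r"
    using disj finite_edges[OF G] injE
    by (subst card_Un_disjoint) (simp_all add: E1_def E2_def card_image)
  then have card: "card (edges G') = m" using m by (simp add: G'_def r_def)
  have edge: "{f u, f v} \<in> edges G' \<longleftrightarrow> {u, v} \<in> edges G" if uv: "u \<in> verts G" "v \<in> verts G" for u v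
  proof
    assume "{u, v} \<in> edges G"
    then have "f ` {u, v} \<in> E1" unfolding E1_def by (rule imageI)
    then show "{f u, f v} \<in> edges G'" by (simp add: G'_def)
  next
    assume "{f u, f v} \<in> edges G'"
    moreover have "{f u, f v} \<notin> E2"
      using uv fV by (force simp: E2_def doubleton_eq_iff)
    ultimately have "{f u, f v} \<in> E1" by (simp add: G'_def)
    then obtain e where e: "e \<in> edges G" "f ` e = f ` {u, v}" by (auto simp: E1_def)
    then have "e = {u, v}" using inj_on_image_eq_iff[OF injf, of e "{u, v}"] eV(1) uv by simp
    with e show "{u, v} \<in> edges G" by simp
  qed
  let ?S = "{S. S \<subseteq> verts G \<and> graph_iso (induced_subgraph G S) H}"
  let ?S' = "{S. S \<subseteq> verts G' \<and> graph_iso (induced_subgraph G' S) H}"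
  have "(\<lambda>S. f ` S) ` ?S \<subseteq> ?S'"
  proof (clarify, rule conjI)
    fix S assume S: "S \<subseteq> verts G" and "graph_iso (induced_subgraph G S) H"
    then obtain g where g: "bij_betw g S (verts H)"
      "\<And>u v. u \<in> S \<Longrightarrow> v \<in> S \<Longrightarrow> {u, v} \<in> edges G \<longleftrightarrow> {g u, g v} \<in> edges H"
      unfolding graph_iso_def induced_subgraph_def by auto
    have "f ` S \<subseteq> {0..<n}" unfolding fV[symmetric] using S by (rule image_mono)
    also have "{0..<n} \<subseteq> verts G'" by (auto simp: G'_def)
    finally show "f ` S \<subseteq> verts G'" .
    have injS: "inj_on f S" using injf S by (rule inj_on_subset)
    define h where "h = g \<circ> the_inv_into S f"
    have "bij_betw f S (f ` S)" using injS by (simp add: bij_betw_def)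
    then have "bij_betw h (f ` S) (verts H)"
      unfolding h_def by (rule bij_betw_trans[OF bij_betw_the_inv_into g(1)])
    moreover have "h (f u) = g u" if "u \<in> S" for u
      using that injS by (simp add: h_def the_inv_into_f_f)
    ultimately show "graph_iso (induced_subgraph G' (f ` S)) H"
      unfolding graph_iso_def using g(2) edge S
      by (intro exI[of _ h]) (auto simp: induced_subgraph_def subset_iff)
  qed
  moreover have "inj_on (\<lambda>S. f ` S) ?S"
    by (rule inj_onI) (use inj_on_image_eq_iff[OF injf] in blast)
  moreover have "finite ?S'" using simple by (simp add: simple_graph_def)
  ultimately have "induced_count G H \<le> induced_count G' H"
    unfolding induced_count_def by (intro card_inj_on_le)
  also have "\<dots> \<le> rho H m"
    unfolding rho_def
  proof (rule Max_ge)
    have "{induced_count G H | G :: nat graph. simple_graph G \<and> card (edges G) = m} \<subseteq> {..nat \<lfloor>b\<rfloor>}"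
      using bound by (auto simp: le_nat_floor)
    then show "finite {induced_count G H | G :: nat graph. simple_graph G \<and> card (edges G) = m}"
      by (rule finite_subset) simp
  qed (use simple card in blast)
  finally show ?thesis .
qed

section \<open>Lower bounds\<close>

text \<open>The cycle of length \<open>2 * l\<close> with every second vertex replaced by \<open>n\<close> independent copies.\<close>

definition blown_up_cycle :: "nat \<Rightarrow> nat \<Rightarrow> (nat + nat \<times> nat) graph" where
  "blown_up_cycle l n = (Inl ` {..<l} \<union> Inr ` ({..<l} \<times> {..<n}),
     {{Inl a, Inr (i, j)} | a i j. i < l \<and> j < n \<and> (a = i \<or> a = Suc i mod l)})"

lemma blown_up_cycle_edge_iff:
  "{x} \<notin> edges (blown_up_cycle l n)"
  "{Inl a, Inl b} \<notin> edges (blown_up_cycle l n)"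
  "{Inr p, Inr q} \<notin> edges (blown_up_cycle l n)"
  "{Inl a, Inr (i, j)} \<in> edges (blown_up_cycle l n) \<longleftrightarrow> i < l \<and> j < n \<and> (a = i \<or> a = Suc i mod l)"
  "{Inr (i, j), Inl a} \<in> edges (blown_up_cycle l n) \<longleftrightarrow> i < l \<and> j < n \<and> (a = i \<or> a = Suc i mod l)"
  by (auto simp: blown_up_cycle_def doubleton_eq_iff)

lemma simple_blown_up_cycle: "simple_graph (blown_up_cycle l n)"
  by (auto simp: simple_graph_def blown_up_cycle_def)

lemma card_edges_blown_up_cycle: "card (edges (blown_up_cycle l n)) \<le> 2 * l * n"
proof -
  let ?F = "\<lambda>(b, i, j). {Inl (if b then i else Suc i mod l), Inr (i, j)}"
  have "edges (blown_up_cycle l n) \<subseteq> ?F ` (UNIV \<times> {..<l} \<times> {..<n})"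
  proof
    fix e assume "e \<in> edges (blown_up_cycle l n)"
    then obtain a i j where "e = {Inl a, Inr (i, j)}" "i < l" "j < n" "a = i \<or> a = Suc i mod l"
      by (auto simp: blown_up_cycle_def)
    then show "e \<in> ?F ` (UNIV \<times> {..<l} \<times> {..<n})"
      by (intro image_eqI[of _ _ "(a = i, i, j)"]) auto
  qed
  then have "card (edges (blown_up_cycle l n)) \<le> card (?F ` (UNIV \<times> {..<l} \<times> {..<n}))"
    by (rule card_mono[rotated]) simp
  also have "\<dots> \<le> card ((UNIV :: bool set) \<times> {..<l} \<times> {..<n})" by (rule card_image_le) simp
  finally show ?thesis by (simp add: card_cartesian_product)
qed

text \<open>One copy \<open>xs ! i\<close> for each position \<open>i\<close>, together with the
  \<open>l\<close> vertices that were not replaced, induces a cycle; different choices give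
  different vertex sets.\<close>

lemma induced_count_blown_up_cycle:
  assumes l: "l \<ge> 2"
  shows "n ^ l \<le> induced_count (blown_up_cycle l n) (cycle_graph (2 * l))"
proof -
  let ?G = "blown_up_cycle l n"
  let ?X = "{xs. set xs \<subseteq> {..<n} \<and> length xs = l}"
  let ?S = "\<lambda>xs. Inl ` {..<l} \<union> (\<lambda>i. Inr (i, xs ! i)) ` {..<l}"
  let ?C = "{S. S \<subseteq> verts ?G \<and> graph_iso (induced_subgraph ?G S) (cycle_graph (2 * l))}"
  have "?S ` ?X \<subseteq> ?C"
  proof (rule image_subsetI, unfold mem_Collect_eq, rule conjI)
    fix xs assume xs: "set xs \<subseteq> {..<n} \<and> length xs = l"
    then have xsn: "xs ! i < n" if "i < l" for i
      using that subsetD[OF conjunct1[OF xs] nth_mem, of i] by simp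
    show "?S xs \<subseteq> verts ?G" using xsn by (auto simp: blown_up_cycle_def)
    \<comment> \<open>The vertices that were not replaced take the even places of the cycle, the
      chosen copies the odd ones.\<close>
    define f :: "nat + nat \<times> nat \<Rightarrow> nat" where
      "f = case_sum (\<lambda>a. 2 * a) (\<lambda>(i, j). 2 * i + 1)"
    have f: "f (Inl a) = 2 * a" "f (Inr (i, j)) = 2 * i + 1" for a i j by (simp_all add: f_def)
    have inj: "inj_on f (?S xs)" by (auto simp: inj_on_def f) presburger+
    moreover have "f ` ?S xs = {..<2 * l}"
    proof
      show "{..<2 * l} \<subseteq> f ` ?S xs"
      proof
        fix b assume "b \<in> {..<2 * l}"
        then have b: "b div 2 < l" by auto
        show "b \<in> f ` ?S xs"
        proof (cases "even b")
          case True
          then have "b = f (Inl (b div 2))" by (simp add: f)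
          then show ?thesis using b by blast
        next
          case False
          then have "b = f (Inr (b div 2, xs ! (b div 2)))" by (simp add: f)
          then show ?thesis using b by blast
        qed
      qed
    qed (auto simp: f)
    ultimately have bij: "bij_betw f (?S xs) {..<2 * l}" by (simp add: bij_betw_def)
    have lt: "f u < 2 * l" if "u \<in> ?S xs" for u using bij that by (auto simp: bij_betw_def)
    have ev: "2 * a = Suc (2 * i + 1) mod (2 * l) \<longleftrightarrow> a = Suc i mod l" for a i
      using mult_mod_right[of 2 "Suc i" l] by auto
    have od: "2 * i + 1 = Suc (2 * a) mod (2 * l) \<longleftrightarrow> i = a" if "a < l" for a i
      using that by auto
    have par: "2 * a \<noteq> Suc (2 * b) mod (2 * l)" "2 * a + 1 \<noteq> Suc (2 * b + 1) mod (2 * l)" for a b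
      using mult_mod_right[of 2 "Suc b" l] l
      by (metis dvd_mod_iff dvd_triv_left even_Suc mult.commute, metis dvd_mod_iff dvd_triv_left even_Suc even_add odd_one)
    have eo: "2 * a \<noteq> Suc (2 * b)" for a b :: nat by presburger
    have "{u, v} \<in> edges ?G \<longleftrightarrow> {f u, f v} \<in> edges (cycle_graph (2 * l))"
      if u: "u \<in> ?S xs" and v: "v \<in> ?S xs" for u v
      unfolding cycle_graph_doubleton[OF lt[OF u] lt[OF v]]
      using u v ev od par xsn eo by (auto simp: blown_up_cycle_edge_iff f simp del: mult_Suc_right)
    with bij show "graph_iso (induced_subgraph ?G (?S xs)) (cycle_graph (2 * l))"
      unfolding graph_iso_def induced_subgraph_def
      by (intro exI[of _ f]) (auto simp: cycle_graph_def)
  qed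
  moreover have "inj_on ?S ?X"
  proof (rule inj_onI)
    fix xs ys assume *: "xs \<in> ?X" "ys \<in> ?X" "?S xs = ?S ys"
    show "xs = ys"
    proof (rule nth_equalityI)
      fix i assume "i < length xs"
      then have "Inr (i, xs ! i) \<in> ?S xs" using *(1) by auto
      then have "Inr (i, xs ! i) \<in> ?S ys" by (simp only: *(3))
      then show "xs ! i = ys ! i" by auto
    qed (use * in auto)
  qed
  moreover have "finite ?C" by (rule finite_subset[of _ "Pow (verts ?G)"]) (auto simp: blown_up_cycle_def)
  ultimately have "card ?X \<le> card ?C" by (intro card_inj_on_le)
  then show ?thesis by (simp add: induced_count_def card_lists_length_eq)
qed

text \<open>For \<open>l = 2\<close> the blown-up cycle is the complete bipartite graph with parts 2
  and \<open>2 * n\<close>, which has only about \<open>m ^ 2 / 8\<close> induced 4-cycles; equal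
  parts give \<open>m ^ 2 / 4\<close>.\<close>

definition balanced_bipartite :: "nat \<Rightarrow> (nat + nat) graph" where
  "balanced_bipartite n = (Inl ` {..<n} \<union> Inr ` {..<n}, {{Inl a, Inr b} | a b. a < n \<and> b < n})"

lemma simple_balanced_bipartite: "simple_graph (balanced_bipartite n)"
  by (auto simp: simple_graph_def balanced_bipartite_def)

lemma card_edges_balanced_bipartite: "card (edges (balanced_bipartite n)) \<le> n ^ 2"
proof -
  have "edges (balanced_bipartite n) = (\<lambda>(a, b). {Inl a, Inr b}) ` ({..<n} \<times> {..<n})"
    by (auto simp: balanced_bipartite_def)
  then show ?thesis
    using card_image_le[of "{..<n} \<times> {..<n}" "\<lambda>(a, b). {Inl a, Inr b}"]
    by (simp add: card_cartesian_product power2_eq_square)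
qed

lemma induced_count_balanced_bipartite:
  "(n choose 2) ^ 2 \<le> induced_count (balanced_bipartite n) (cycle_graph 4)"
proof -
  let ?G = "balanced_bipartite n"
  let ?X = "{A. A \<subseteq> {..<n} \<and> card A = 2}"
  let ?S = "\<lambda>(A, B). Inl ` A \<union> Inr ` B"
  let ?C = "{S. S \<subseteq> verts ?G \<and> graph_iso (induced_subgraph ?G S) (cycle_graph 4)}"
  have "?S ` (?X \<times> ?X) \<subseteq> ?C"
  proof (clarify, rule conjI)
    fix A B assume A: "A \<subseteq> {..<n}" "card A = 2" and B: "B \<subseteq> {..<n}" "card B = 2"
    from A(2) obtain a a' where a: "A = {a, a'}" "a \<noteq> a'" by (auto simp: card_2_iff)
    from B(2) obtain b b' where b: "B = {b, b'}" "b \<noteq> b'" by (auto simp: card_2_iff)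
    show "Inl ` A \<union> Inr ` B \<subseteq> verts ?G" using A B by (auto simp: balanced_bipartite_def)
    define f :: "nat + nat \<Rightarrow> nat" where
      "f = case_sum (\<lambda>x. if x = a then 0 else 2) (\<lambda>y. if y = b then 1 else 3)"
    have f: "f (Inl a) = 0" "f (Inl a') = 2" "f (Inr b) = 1" "f (Inr b') = 3"
      using a b by (auto simp: f_def)
    have "{..<4} = {0, 1, 2, 3 :: nat}" by auto
    then have bij: "bij_betw f (Inl ` A \<union> Inr ` B) {..<4}"
      unfolding a b bij_betw_def by (auto simp: inj_on_def f)
    have "{x, y} \<in> edges (cycle_graph 4) \<longleftrightarrow> x = Suc y mod 4 \<or> y = Suc x mod 4" if "x < 4" "y < 4" for x y
      using that by (rule cycle_graph_doubleton)
    moreover from this[of x x for x] have "{x} \<notin> edges (cycle_graph 4)" if "x < 4" for x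
      using that by (auto simp: mod_Suc split: if_splits)
    moreover have "{Inl x, Inr y} \<in> edges ?G" "{Inr y, Inl x} \<in> edges ?G" if "x < n" "y < n" for x y
      using that by (auto simp: balanced_bipartite_def)
    moreover have "{x} \<notin> edges ?G" for x
      by (auto simp: balanced_bipartite_def)
    moreover have "{Inl x, Inl y} \<notin> edges ?G" "{Inr x, Inr y} \<notin> edges ?G" for x y
      by (auto simp: balanced_bipartite_def doubleton_eq_iff)
    ultimately have "{u, v} \<in> edges ?G \<longleftrightarrow> {f u, f v} \<in> edges (cycle_graph 4)"
      if "u \<in> Inl ` A \<union> Inr ` B" "v \<in> Inl ` A \<union> Inr ` B" for u v
      using that A(1) B(1) unfolding a b by (auto simp: f doubleton_eq_iff)
    with bij show "graph_iso (induced_subgraph ?G (Inl ` A \<union> Inr ` B)) (cycle_graph 4)"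
      unfolding graph_iso_def induced_subgraph_def
      by (intro exI[of _ f]) (auto simp: cycle_graph_def)
  qed
  moreover have "inj_on ?S (?X \<times> ?X)"
  proof (rule inj_onI, clarify)
    fix A B A' B' :: "nat set" assume eq: "Inl ` A \<union> Inr ` B = Inl ` A' \<union> Inr ` B'"
    have "Inl -` (Inl ` A \<union> Inr ` B) = A" "Inr -` (Inl ` A \<union> Inr ` B) = B" for A B :: "nat set"
      by auto
    then show "A = A' \<and> B = B'" using eq by metis
  qed
  moreover have "finite ?C" by (rule finite_subset[of _ "Pow (verts ?G)"]) (auto simp: balanced_bipartite_def)
  ultimately have "card (?X \<times> ?X) \<le> card ?C" by (intro card_inj_on_le)
  moreover have "card ?X = n choose 2" using n_subsets[of "{..<n}" 2] by simp
  ultimately show ?thesis by (simp add: induced_count_def card_cartesian_product power2_eq_square)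
qed

text \<open>Blow up with \<open>n = m div k\<close>; replacing \<open>m / k\<close> by its integer
  part costs the factor \<open>\<delta> m ^ l\<close>, which tends to 1. \<open>B\<close> makes the
  maximum in \<open>rho\<close> well defined.\<close>

lemma rho_cycle_even_asymptotic_ge:
  fixes B :: "nat \<Rightarrow> real"
  assumes l: "l \<ge> 2"
    and bound: "\<And>G :: nat graph. simple_graph G \<Longrightarrow>
      real (induced_count G (cycle_graph (2 * l))) \<le> B (card (edges G))"
  shows "\<exists>\<epsilon> :: nat \<Rightarrow> real. \<epsilon> \<longlonglongrightarrow> 0 \<and>
    (\<forall>m>0. (1 + \<epsilon> m) * (real m / real (2 * l)) ^ l \<le> real (rho (cycle_graph (2 * l)) m))"
proof -
  define k where "k = 2 * l"
  have k: "k > 0" using l by (simp add: k_def)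
  define \<delta> where "\<delta> = (\<lambda>m. real (m div k) * real k / real m)"
  have "\<delta> \<longlonglongrightarrow> 1"
  proof (rule tendsto_sandwich)
    show "eventually (\<lambda>m. 1 - real k / real m \<le> \<delta> m) sequentially"
      using eventually_gt_at_top[of 0]
    proof eventually_elim
      case (elim m)
      have "m = m div k * k + m mod k" by simp
      then have "real m = real (m div k) * real k + real (m mod k)"
        by (metis of_nat_add of_nat_mult)
      moreover have "real (m mod k) \<le> real k" using k by (simp add: less_imp_le)
      ultimately have "real m - real k \<le> real (m div k) * real k" by linarith
      then have "(real m - real k) / real m \<le> \<delta> m"
        unfolding \<delta>_def by (rule divide_right_mono) simp
      with elim show ?case by (simp add: diff_divide_distrib)
    qed
    show "eventually (\<lambda>m. \<delta> m \<le> 1) sequentially"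
    proof (intro always_eventually allI)
      fix m
      have "real (m div k) * real k = real (m div k * k)" by simp
      also have "\<dots> \<le> real m" by (simp only: of_nat_le_iff div_times_less_eq_dividend)
      finally show "\<delta> m \<le> 1" by (auto simp: \<delta>_def divide_le_eq_1)
    qed
    show "(\<lambda>m. 1 - real k / real m) \<longlonglongrightarrow> 1"
      using tendsto_diff[OF tendsto_const[of 1] lim_const_over_n[of "real k"]] by simp
  qed simp
  then have "(\<lambda>m. \<delta> m ^ l - 1) \<longlonglongrightarrow> 1 ^ l - 1" by (intro tendsto_intros)
  moreover have "(1 + (\<delta> m ^ l - 1)) * (real m / real k) ^ l \<le> real (rho (cycle_graph k) m)" if "m > 0" for m
  proof -
    have "(1 + (\<delta> m ^ l - 1)) * (real m / real k) ^ l = (\<delta> m * (real m / real k)) ^ l"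
      unfolding power_mult_distrib by simp
    also have "\<delta> m * (real m / real k) = real (m div k)"
      using that k by (simp add: \<delta>_def)
    also have "real (m div k) ^ l = real ((m div k) ^ l)" by simp
    also have "(m div k) ^ l \<le> induced_count (blown_up_cycle l (m div k)) (cycle_graph k)"
      unfolding k_def by (rule induced_count_blown_up_cycle[OF l])
    also have "\<dots> \<le> rho (cycle_graph k) m"
    proof (rule induced_count_le_rho[OF simple_blown_up_cycle])
      have "card (edges (blown_up_cycle l (m div k))) \<le> k * (m div k)"
        unfolding k_def by (rule card_edges_blown_up_cycle)
      also have "\<dots> \<le> m" by simp
      finally show "card (edges (blown_up_cycle l (m div k))) \<le> m" .
    next
      fix G :: "nat graph" assume "simple_graph G" "card (edges G) = m"
      with bound[of G] show "real (induced_count G (cycle_graph k)) \<le> B m" by (simp add: k_def)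
    qed
    finally show ?thesis by simp
  qed
  ultimately show ?thesis unfolding k_def by (intro exI[of _ "\<lambda>m. \<delta> m ^ l - 1"]) simp
qed

lemma rho_cycle_4_asymptotic:
  "\<exists>\<epsilon> :: nat \<Rightarrow> real. \<epsilon> \<longlonglongrightarrow> 0 \<and>
    (\<forall>m>0. real (rho (cycle_graph 4) m) = (1 + \<epsilon> m) * (real m ^ 2 / 4))"
proof -
  define \<epsilon> where "\<epsilon> = (\<lambda>m. real (rho (cycle_graph 4) m) / (real m ^ 2 / 4) - 1)"
  have upper: "real (rho (cycle_graph 4) m) \<le> real m ^ 2 / 4" for m
    by (rule rho_le) (use induced_count_cycle_4_le in blast)
  \<comment> \<open>Both parts have size \<open>floor (sqrt m)\<close>. For \<open>m >= 4\<close>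
    the factor \<open>r - 2\<close> is nonnegative, so the estimate of the binomial coefficient may
    be squared.\<close>
  have lower: "(1 - 1 / sqrt (real m)) ^ 2 * (1 - 2 / sqrt (real m)) ^ 2 * (real m ^ 2 / 4)
      \<le> real (rho (cycle_graph 4) m)" if m: "m \<ge> 4" for m
  proof -
    define r where "r = sqrt (real m)"
    have "sqrt (2 ^ 2) \<le> r" unfolding r_def using m by (intro real_sqrt_le_mono) simp
    then have r: "r \<ge> 2" by simp
    have r2: "r ^ 2 = real m" by (simp add: r_def)
    define n where "n = nat \<lfloor>r\<rfloor>"
    have n: "real n \<le> r" "r - 1 \<le> real n" using r unfolding n_def by linarith+
    have "real (n ^ 2) \<le> real m" using n r unfolding r2[symmetric] by (simp add: power_mono)
    then have nm: "n ^ 2 \<le> m" by (simp only: of_nat_le_iff)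
    have "real (n choose 2) = real n * (real n - 1) / 2"
    proof -
      have "even (n * (n - 1))" by auto
      then have "real (n * (n - 1) div 2) = real (n * (n - 1)) / 2" by (simp only: real_of_nat_div)
      moreover have "real (n - 1) = real n - 1" using n r by (simp add: of_nat_diff)
      ultimately show ?thesis by (simp add: choose_two)
    qed
    then have "((r - 1) * (r - 2) / 2) ^ 2 \<le> real (n choose 2) ^ 2"
      using n r by (intro power_mono) (auto intro!: mult_mono divide_right_mono)
    also have "\<dots> = real ((n choose 2) ^ 2)" by simp
    also have "(n choose 2) ^ 2 \<le> induced_count (balanced_bipartite n) (cycle_graph 4)"
      by (rule induced_count_balanced_bipartite)
    also have "\<dots> \<le> rho (cycle_graph 4) m"
    proof (rule induced_count_le_rho[OF simple_balanced_bipartite])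
      show "card (edges (balanced_bipartite n)) \<le> m"
        using card_edges_balanced_bipartite[of n] nm by linarith
      show "real (induced_count G (cycle_graph 4)) \<le> real m ^ 2 / 4"
        if "simple_graph G" "card (edges G) = m" for G :: "nat graph"
        using induced_count_cycle_4_le[OF that(1)] that(2) by simp
    qed
    finally have "((r - 1) * (r - 2) / 2) ^ 2 \<le> real (rho (cycle_graph 4) m)" by simp
    moreover have "(1 - 1 / r) * r = r - 1" "(1 - 2 / r) * r = r - 2" using r by (simp_all add: field_simps)
    then have "((1 - 1 / r) * r * ((1 - 2 / r) * r) / 2) ^ 2 = ((r - 1) * (r - 2) / 2) ^ 2" by simp
    then have "(1 - 1 / r) ^ 2 * (1 - 2 / r) ^ 2 * ((r ^ 2) ^ 2 / 4) = ((r - 1) * (r - 2) / 2) ^ 2"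
      by (simp add: power_mult_distrib power_divide mult_ac)
    ultimately show ?thesis by (simp add: r2 r_def)
  qed
  have "\<epsilon> \<longlonglongrightarrow> 0"
  proof (rule tendsto_sandwich)
    show "eventually (\<lambda>m. (1 - 1 / sqrt (real m)) ^ 2 * (1 - 2 / sqrt (real m)) ^ 2 - 1 \<le> \<epsilon> m) sequentially"
      using eventually_ge_at_top[of 4]
    proof eventually_elim
      case (elim m)
      then have "real m ^ 2 / 4 > 0" by simp
      with lower[OF elim] show ?case unfolding \<epsilon>_def by (simp only: pos_le_divide_eq diff_right_mono)
    qed
    show "eventually (\<lambda>m. \<epsilon> m \<le> 0) sequentially"
    proof (intro always_eventually allI)
      fix m show "\<epsilon> m \<le> 0"
        using upper[of m] unfolding \<epsilon>_def by (cases "m = 0") (simp_all add: divide_le_eq_1)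
    qed
    have "filterlim (\<lambda>m. sqrt (real m)) at_top sequentially"
      by (rule filterlim_compose[OF sqrt_at_top filterlim_real_sequentially])
    then have "(\<lambda>m. c / sqrt (real m)) \<longlonglongrightarrow> 0" for c
      by (intro tendsto_divide_0[OF tendsto_const] filterlim_at_top_imp_at_infinity)
    then have "(\<lambda>m. (1 - 1 / sqrt (real m)) ^ 2 * (1 - 2 / sqrt (real m)) ^ 2 - 1) \<longlonglongrightarrow>
        (1 - 0) ^ 2 * (1 - 0) ^ 2 - 1"
      by (intro tendsto_intros)
    then show "(\<lambda>m. (1 - 1 / sqrt (real m)) ^ 2 * (1 - 2 / sqrt (real m)) ^ 2 - 1) \<longlonglongrightarrow> 0"
      by simp
  qed simp
  moreover have "real (rho (cycle_graph 4) m) = (1 + \<epsilon> m) * (real m ^ 2 / 4)" if "m > 0" for m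
    using that by (simp add: \<epsilon>_def)
  ultimately show ?thesis by blast
qed

theorem theorem1p6:
  shows "(\<exists>\<epsilon> :: nat \<Rightarrow> real. \<epsilon> \<longlonglongrightarrow> 0 \<and>
            (\<forall>m>0. real (rho (cycle_graph 4) m) = (1 + \<epsilon> m) * (real m ^ 2 / 4)))
       \<and> (\<exists>\<epsilon> :: nat \<Rightarrow> real. \<epsilon> \<longlonglongrightarrow> 0 \<and>
            (\<forall>m>0. (1 + \<epsilon> m) * (real m / 6) ^ 3 \<le> real (rho (cycle_graph 6) m)))
       \<and> (\<forall>m>0. real (rho (cycle_graph 6) m) \<le> 3 * (real m / 6) ^ 3)
       \<and> (\<forall>k l :: nat. k = 2 * l \<and> k \<ge> 8 \<longrightarrow>
            (\<exists>\<epsilon> :: nat \<Rightarrow> real. \<epsilon> \<longlonglongrightarrow> 0 \<and>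
               (\<forall>m>0. (1 + \<epsilon> m) * (real m / real k) ^ (k div 2) \<le> real (rho (cycle_graph k) m)))
          \<and> (\<forall>m>0. real (rho (cycle_graph k) m)
                      \<le> (real m / (2 * real l)) ^ l * (1 + 1 / (real l - 1)) ^ (l - 1)
                 \<and> (real m / (2 * real l)) ^ l * (1 + 1 / (real l - 1)) ^ (l - 1)
                      \<le> exp 1 * (real m / real k) ^ (k div 2)))"
proof (intro conjI allI impI)
  show "\<exists>\<epsilon> :: nat \<Rightarrow> real. \<epsilon> \<longlonglongrightarrow> 0 \<and>
      (\<forall>m>0. real (rho (cycle_graph 4) m) = (1 + \<epsilon> m) * (real m ^ 2 / 4))"
    by (rule rho_cycle_4_asymptotic)
next
  show "\<exists>\<epsilon> :: nat \<Rightarrow> real. \<epsilon> \<longlonglongrightarrow> 0 \<and>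
      (\<forall>m>0. (1 + \<epsilon> m) * (real m / 6) ^ 3 \<le> real (rho (cycle_graph 6) m))"
    using rho_cycle_even_asymptotic_ge[of 3 "\<lambda>m. 3 * (real m / 6) ^ 3"]
    by (simp add: induced_count_cycle_6_le)
next
  fix m :: nat
  show "real (rho (cycle_graph 6) m) \<le> 3 * (real m / 6) ^ 3"
    by (rule rho_le) (use induced_count_cycle_6_le in blast)
next
  fix k l :: nat assume kl: "k = 2 * l \<and> k \<ge> 8"
  then have l: "l \<ge> 4" and k: "k = 2 * l" "k div 2 = l" by auto
  show "\<exists>\<epsilon> :: nat \<Rightarrow> real. \<epsilon> \<longlonglongrightarrow> 0 \<and>
      (\<forall>m>0. (1 + \<epsilon> m) * (real m / real k) ^ (k div 2) \<le> real (rho (cycle_graph k) m))"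
    unfolding k(2) unfolding k(1)
    by (rule rho_cycle_even_asymptotic_ge[OF _ induced_count_cycle_even_le]) (use l in simp_all)
  fix m :: nat
  show "real (rho (cycle_graph k) m) \<le> (real m / (2 * real l)) ^ l * (1 + 1 / (real l - 1)) ^ (l - 1)"
    unfolding k(1) by (rule rho_le) (use induced_count_cycle_even_le[OF _ l] in blast)
  have "(1 + 1 / (real l - 1)) ^ (l - 1) \<le> exp (1 / (real l - 1)) ^ (l - 1)"
    using l by (intro power_mono exp_ge_add_one_self) simp
  also have "\<dots> = exp 1"
    using l by (simp add: exp_of_nat_mult[symmetric] of_nat_diff)
  finally show "(real m / (2 * real l)) ^ l * (1 + 1 / (real l - 1)) ^ (l - 1)
      \<le> exp 1 * (real m / real k) ^ (k div 2)"
    unfolding k(2) by (simp add: k(1) mult.commute[of "exp 1"] mult_left_mono)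
qed

end
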